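(* Let $\mathbb{G}$ be a homogeneous group of homogeneous dimension $Q$, equipped with a homogeneous quasi-norm $|\cdot|$. Let $\phi:\mathbb{R}^+\to\mathbb{R}^+$ be a function defining the generalised Morrey space $L^{p,\phi}(\mathbb{G})$. For any $f\in L^{p,\phi}(\mathbb{G})$ and $1<p<\infty$, we have $$\|Mf\|_{L^{p,\phi}(\mathbb{G})}\leq C_{p}\|f\|_{L^{p,\phi}(\mathbb{G})},$$ where $M$ is the Hardy-Littlewood maximal operator, defined by averages over the quasi-balls $B(0,r)$ centred at the identity.
   Context: A homogeneous group $\mathbb{G}$ is a connected simply connected Lie group whose Lie algebra $\mathfrak{g}$ is equipped with dilations $D_\lambda=\mathrm{Exp}(A\ln\lambda)$, $\lambda>0$, where $A$ is a diagonalisable positive linear operator on $\mathfrak g$ and each $D_\lambda$ is a Lie algebra morphism; the dilations are transported to $\mathbb{G}$ by the exponential map (a global diffeomorphism). The homogeneous dimension is $Q=\mathrm{Tr}\,A$. A homogeneous quasi-norm is a continuous function $|\cdot|:\mathbb{G}\to[0,\infty)$ with $|x^{-1}|=|x|$, $|\lambda x|=\lambda|x|$ for $\lambda>0$, and $|x|=0$ if and only if $x$ is the identity element $0$. $dx$ is the Haar measure. $B(x,r)=\{y\in\mathbb{G}:|x^{-1}y|<r\}$. $\mathbb{R}^+=(0,\infty)$. Generalised Morrey space: for $\phi:\mathbb{R}^+\to\mathbb{R}^+$ and $1\le p<\infty$, $$L^{p,\phi}(\mathbb{G})=\{f\in L^p_{loc}(\mathbb{G}):\|f\|_{L^{p,\phi}(\mathbb{G})}<\infty\},\quad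 \|f\|_{L^{p,\phi}(\mathbb{G})}=\sup_{r>0}\frac{1}{\phi(r)}\left(\frac{1}{r^{Q}}\int_{B(0,r)}|f(x)|^{p}dx\right)^{1/p},$$ where it is assumed that $\phi$ is nonincreasing and $t^{Q/p}\phi(t)$ is nondecreasing (so that $\phi$ is doubling). The Hardy-Littlewood maximal operator $M$ is defined for $f\in L^p_{loc}(\mathbb{G})$ by $$Mf(x)=\sup_{x\in B}\frac{1}{|B(0,r)|}\int_{B(0,r)}|f(y)|dy,\quad x\in\mathbb{G},$$ where $|B(0,r)|$ denotes the Haar measure of the ball $B=B(0,r)$; that is, the supremum is over the quasi-balls $B=B(0,r)$ centred at the identity that contain $x$. $C_p$ is a positive constant not depending on $f$; the subscript is the paper's indication of the parameter it depends on. *)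

theory Defs
  imports "HOL-Analysis.Analysis"
begin

section \<open>Homogeneous groups\<close>

text \<open>
  Groups are written additively, as in the library class \<^class>\<open>topological_group_add\<close>, which does
  not assume commutativity: \<open>x + y\<close> is the group product, \<open>- x\<close> the inverse and \<open>0\<close> the identity.
\<close>

primrec n_times_differentiable ::
    "nat \<Rightarrow> ('b::real_normed_vector \<Rightarrow> 'c::real_normed_vector) \<Rightarrow> bool" where
  "n_times_differentiable 0 f \<longleftrightarrow> continuous_on UNIV f"
| "n_times_differentiable (Suc n) f \<longleftrightarrow>
     (\<forall>x. f differentiable (at x)) \<and>
     (\<forall>v. n_times_differentiable n (\<lambda>x. frechet_derivative f (at x) v))"

definition smooth :: "('b::real_normed_vector \<Rightarrow> 'c::real_normed_vector) \<Rightarrow> bool" where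
  "smooth f \<longleftrightarrow> (\<forall>n. n_times_differentiable n f)"

text \<open>
  A Lie group \<open>'g\<close> whose exponential map \<open>E\<close> is a global diffeomorphism from the Lie algebra \<open>'a\<close>
  (the tangent space at the identity) onto the group, as is the case for every homogeneous group.
  The manifold structure of \<open>'g\<close> is therefore the one given by the single chart \<open>inv E\<close>; the group
  is connected and simply connected, being homeomorphic to a vector space. The last assumption says
  that each \<open>t \<mapsto> E (t x)\<close> is a one-parameter subgroup. Its velocity at \<open>0\<close> is \<open>x\<close> in
  this chart, so \<open>E\<close> is indeed the exponential map. Only the vector space structure and the topology
  of \<open>'a\<close> are used: its inner product plays no role.
\<close>

locale exponential_lie_group =
  fixes E :: "'a::euclidean_space \<Rightarrow> 'g::{topological_group_add, t2_space, second_countable_topology}"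
  assumes exp_homeomorphism: "homeomorphism UNIV UNIV E (inv E)"
    and smooth_mult: "smooth (\<lambda>(x, y). inv E (E x + E y))"
    and smooth_inverse: "smooth (\<lambda>x. inv E (- E x))"
    and one_parameter: "\<And>s t x. E ((s + t) *\<^sub>R x) = E (s *\<^sub>R x) + E (t *\<^sub>R x)"

text \<open>
  The adjoint representation is the derivative at the identity of conjugation, computed in the chart
  \<open>inv E\<close>; the Lie bracket is \<open>[x, y] = ad x y\<close>, where \<open>ad\<close> is the differential of \<open>Ad\<close>.
\<close>

definition Ad :: "('a::euclidean_space \<Rightarrow> 'g::group_add) \<Rightarrow> 'g \<Rightarrow> 'a \<Rightarrow> 'a" where
  "Ad E g y = vector_derivative (\<lambda>t. inv E (g + E (t *\<^sub>R y) - g)) (at 0)"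

definition lie_bracket :: "('a::euclidean_space \<Rightarrow> 'g::group_add) \<Rightarrow> 'a \<Rightarrow> 'a \<Rightarrow> 'a" where
  "lie_bracket E x y = vector_derivative (\<lambda>s. Ad E (E (s *\<^sub>R x)) y) (at 0)"

definition lie_algebra_morphism ::
    "('a::euclidean_space \<Rightarrow> 'g::group_add) \<Rightarrow> ('a \<Rightarrow> 'a) \<Rightarrow> bool" where
  "lie_algebra_morphism E T \<longleftrightarrow>
     linear T \<and> (\<forall>x y. T (lie_bracket E x y) = lie_bracket E (T x) (T y))"

definition diagonalisable_positive :: "('a::real_vector \<Rightarrow> 'a) \<Rightarrow> bool" where
  "diagonalisable_positive A \<longleftrightarrow>
     linear A \<and>
     (\<exists>B. independent B \<and> span B = UNIV \<and> (\<forall>b\<in>B. \<exists>c>0. A b = c *\<^sub>R b))"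

text \<open>The operator \<open>Exp (A ln s)\<close>, as an exponential power series.\<close>

definition dilation :: "('a::real_normed_vector \<Rightarrow> 'a) \<Rightarrow> real \<Rightarrow> 'a \<Rightarrow> 'a" where
  "dilation A s x = (\<Sum>k. (ln s ^ k / fact k) *\<^sub>R (A ^^ k) x)"

locale homogeneous_group = exponential_lie_group E
  for E :: "'a::euclidean_space \<Rightarrow> 'g::{topological_group_add, t2_space, second_countable_topology}" +
  fixes A :: "'a \<Rightarrow> 'a"
  assumes generator: "diagonalisable_positive A"
    and dilation_morphism: "\<And>s. s > 0 \<Longrightarrow> lie_algebra_morphism E (dilation A s)"

definition group_dilation ::
    "('a::euclidean_space \<Rightarrow> 'g::group_add) \<Rightarrow> ('a \<Rightarrow> 'a) \<Rightarrow> real \<Rightarrow> 'g \<Rightarrow> 'g" where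
  "group_dilation E A s g = E (dilation A s (inv E g))"

definition operator_trace :: "('a::euclidean_space \<Rightarrow> 'a) \<Rightarrow> real" where
  "operator_trace A = (\<Sum>b\<in>Basis. A b \<bullet> b)"

definition homogeneous_quasi_norm ::
    "('a::euclidean_space \<Rightarrow> 'g::{topological_space, group_add}) \<Rightarrow> ('a \<Rightarrow> 'a) \<Rightarrow> ('g \<Rightarrow> real) \<Rightarrow> bool"
  where
  "homogeneous_quasi_norm E A N \<longleftrightarrow>
     continuous_on UNIV N \<and>
     (\<forall>x. 0 \<le> N x) \<and>
     (\<forall>x. N (- x) = N x) \<and>
     (\<forall>s>0. \<forall>x. N (group_dilation E A s x) = s * N x) \<and>
     (\<forall>x. N x = 0 \<longleftrightarrow> x = 0)"

definition quasi_ball :: "('g::group_add \<Rightarrow> real) \<Rightarrow> 'g \<Rightarrow> real \<Rightarrow> 'g set" where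
  "quasi_ball N x r = {y. N (- x + y) < r}"

text \<open>
  On the second countable, locally compact groups considered here, Borel measures that are finite on
  compact sets are automatically regular, so this is the usual notion of a left Haar measure.
\<close>

definition haar_measure :: "'g::{topological_space, group_add} measure \<Rightarrow> bool" where
  "haar_measure \<mu> \<longleftrightarrow>
     sets \<mu> = sets borel \<and>
     (\<forall>K. compact K \<longrightarrow> emeasure \<mu> K < \<infinity>) \<and>
     emeasure \<mu> UNIV \<noteq> 0 \<and>
     (\<forall>g. \<forall>S\<in>sets borel. emeasure \<mu> ((+) g ` S) = emeasure \<mu> S)"


section \<open>Generalised Morrey spaces and the maximal operator\<close>

text \<open>Powers of extended nonnegative reals, for exponents \<open>a > 0\<close>.\<close>

definition ennreal_powr :: "ennreal \<Rightarrow> real \<Rightarrow> ennreal" where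
  "ennreal_powr x a = (if x = \<infinity> then \<infinity> else ennreal (enn2real x powr a))"

definition morrey_weight :: "real \<Rightarrow> real \<Rightarrow> (real \<Rightarrow> real) \<Rightarrow> bool" where
  "morrey_weight Q p \<phi> \<longleftrightarrow>
     (\<forall>t>0. 0 < \<phi> t) \<and>
     antimono_on {0<..} \<phi> \<and>
     mono_on {0<..} (\<lambda>t. t powr (Q / p) * \<phi> t)"

text \<open>
  The norm is a function of \<open>u = |f|\<close>, which may take the value \<open>\<infinity>\<close>: this happens for
  \<open>u = Mf\<close>, for instance at the identity when the averages of \<open>|f|\<close> blow up there.
\<close>

definition morrey_norm ::
    "'g::group_add measure \<Rightarrow> ('g \<Rightarrow> real) \<Rightarrow> real \<Rightarrow> real \<Rightarrow> (real \<Rightarrow> real) \<Rightarrow> ('g \<Rightarrow> ennreal) \<Rightarrow> ennreal"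
  where
  "morrey_norm \<mu> N Q p \<phi> u =
     (SUP r\<in>{0<..}. ennreal (1 / \<phi> r) *
        ennreal_powr (ennreal (1 / r powr Q) *
          (\<integral>\<^sup>+x\<in>quasi_ball N 0 r. ennreal_powr (u x) p \<partial>\<mu>)) (1 / p))"

definition Lp_loc :: "'g::topological_space measure \<Rightarrow> real \<Rightarrow> ('g \<Rightarrow> complex) set" where
  "Lp_loc \<mu> p =
     {f \<in> borel_measurable \<mu>.
        \<forall>K. compact K \<longrightarrow> (\<integral>\<^sup>+x\<in>K. ennreal (norm (f x) powr p) \<partial>\<mu>) < \<infinity>}"

definition morrey_space ::
    "'g::{topological_space, group_add} measure \<Rightarrow> ('g \<Rightarrow> real) \<Rightarrow> real \<Rightarrow> real \<Rightarrow> (real \<Rightarrow> real) \<Rightarrow>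
     ('g \<Rightarrow> complex) set"
  where
  "morrey_space \<mu> N Q p \<phi> =
     {f \<in> Lp_loc \<mu> p. morrey_norm \<mu> N Q p \<phi> (\<lambda>x. ennreal (norm (f x))) < \<infinity>}"

definition maximal_operator ::
    "'g::group_add measure \<Rightarrow> ('g \<Rightarrow> real) \<Rightarrow> ('g \<Rightarrow> complex) \<Rightarrow> 'g \<Rightarrow> ennreal" where
  "maximal_operator \<mu> N f x =
     (SUP r\<in>{r. 0 < r \<and> x \<in> quasi_ball N 0 r}.
        (\<integral>\<^sup>+y\<in>quasi_ball N 0 r. ennreal (norm (f y)) \<partial>\<mu>) / emeasure \<mu> (quasi_ball N 0 r))"

end

theory Submission
  imports Defs
begin

text \<open>
  The balls in question are all centred at the identity, so they form a chain and the maximal function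
  at \<open>x\<close> depends on \<open>|x|\<close> alone. A superlevel set \<open>{M f > t}\<close> is the union of the balls on which the mean
  of \<open>|f|\<close> exceeds \<open>t\<close>. As the union of a chain it inherits from these balls the weak type bound
  \<open>t \<mu>{M f > t} \<le> \<integral> |f|\<close> (\<open>weak_type\<close>), and truncation together with the layer cake formula turns this into
  the strong \<open>L\<^sup>p\<close> bound (\<open>strong_type\<close>). For the Morrey norm, consider \<open>M f\<close> on the ball of radius \<open>R\<close>.
  Means over smaller balls are those of the restriction of \<open>f\<close> to this ball, to which the \<open>L\<^sup>p\<close> bound
  applies. Means over larger balls are bounded, by Jensen's inequality and the monotonicity of \<open>\<phi>\<close>, by a
  multiple of \<open>\<phi> R\<close> times the norm of \<open>f\<close> (\<open>morrey_norm_radial_max\<close>).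

  The last step compares \<open>\<mu> (B(0, r))\<close> with \<open>r powr Q\<close>, and it is here that the geometry of the group
  enters: \<open>\<mu> (B(0, r)) = \<kappa> r powr Q\<close> with \<open>0 < \<kappa> < \<infinity>\<close> (\<open>emeasure_quasi_ball\<close>). This follows once Haar
  measure is known to be a multiple of Lebesgue measure in the exponential chart, because the dilation by
  \<open>r\<close> has determinant \<open>r powr Q\<close>.

  To see that left translations preserve Lebesgue measure in the chart, let \<open>W(x)\<close> be the derivative at \<open>x\<close>
  of \<open>z \<mapsto> log (exp (- x) exp z)\<close>. The Jacobian of a translation is a quotient of values of \<open>det W\<close>.
  Now \<open>W(x) y\<close> is the mean of \<open>Ad (exp (- t x)) y\<close> over \<open>0 \<le> t \<le> 1\<close>, and \<open>Ad (exp (t x))\<close> is the flow of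
  \<open>ad x\<close>; a dilation \<open>D\<close> is a morphism of Lie algebras, so it conjugates \<open>W(x)\<close> into \<open>W(D x)\<close>
  (\<open>log_deriv_morphism\<close>). Thus \<open>det W(D x) = det W(x)\<close>, and letting \<open>D\<close> contract \<open>x\<close> to the origin gives
  \<open>det W(x) = det W(0) = 1\<close> (\<open>ldet_log_deriv\<close>). Finally, any Haar measure is a multiple of the one so obtained
  (\<open>haar_measure_unique\<close>).
\<close>

section \<open>Determinants and change of variables in Euclidean spaces\<close>

text \<open>
  The change of variables theorem speaks of \<open>real ^ 'n\<close> for a finite well-ordered index type \<open>'n\<close>. For
  an arbitrary Euclidean space \<open>'a\<close> the type \<open>'a coord\<close> supplies such an index type with \<open>DIM('a)\<close>
  elements; numbering the basis vectors by natural numbers gives it its well-order.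
\<close>

typedef (overloaded) ('a::euclidean_space) coord = "{..<DIM('a)}"
  by (rule exI[of _ 0]) simp

instance coord :: (euclidean_space) finite
proof
  show "finite (UNIV :: 'a coord set)"
    using type_definition.univ[OF type_definition_coord] by (metis finite_imageI finite_lessThan)
qed

instantiation coord :: (euclidean_space) wellorder
begin
definition "i \<le> j \<longleftrightarrow> Rep_coord i \<le> Rep_coord j"
definition "i < j \<longleftrightarrow> Rep_coord i < Rep_coord j"
instance
proof
  fix P :: "'a coord \<Rightarrow> bool" and i
  assume step: "\<And>i. (\<And>j. j < i \<Longrightarrow> P j) \<Longrightarrow> P i"
  show "P i"
    by (induction i rule: measure_induct_rule[where f = Rep_coord])
      (auto intro: step simp: less_coord_def)
qed (auto simp: less_eq_coord_def less_coord_def Rep_coord_inject)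
end

definition coord_basis :: "'a::euclidean_space coord \<Rightarrow> 'a" where
  "coord_basis = (SOME e. bij_betw e UNIV Basis)"

lemma bij_betw_coord_basis: "bij_betw (coord_basis :: 'a::euclidean_space coord \<Rightarrow> 'a) UNIV Basis"
proof -
  have "card (UNIV :: 'a coord set) = DIM('a)"
    using type_definition.card[OF type_definition_coord] by simp
  then have "\<exists>e :: 'a coord \<Rightarrow> 'a. bij_betw e UNIV Basis"
    by (intro finite_same_card_bij) auto
  then show ?thesis
    unfolding coord_basis_def by (rule someI_ex)
qed

lemma coord_basis_in_Basis [simp]: "coord_basis i \<in> Basis"
  using bij_betw_coord_basis bij_betwE by blast

lemma coord_basis_inner [simp]: "coord_basis i \<bullet> coord_basis j = (if i = j then 1 else 0)"
  using bij_betw_coord_basis by (auto simp: inner_Basis bij_betw_def inj_on_def)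

lemma sum_coord_basis: "(\<Sum>b\<in>Basis. g b) = (\<Sum>i\<in>UNIV. g (coord_basis i))"
  using sum.reindex_bij_betw[OF bij_betw_coord_basis, of g] by simp

lemma prod_coord_basis: "(\<Prod>b\<in>Basis. g b) = (\<Prod>i\<in>UNIV. g (coord_basis i))"
  using prod.reindex_bij_betw[OF bij_betw_coord_basis, of g] by simp

definition of_vec :: "real ^ 'a::euclidean_space coord \<Rightarrow> 'a" where
  "of_vec v = (\<Sum>i\<in>UNIV. v $ i *\<^sub>R coord_basis i)"

definition to_vec :: "'a::euclidean_space \<Rightarrow> real ^ 'a coord" where
  "to_vec x = (\<chi> i. x \<bullet> coord_basis i)"

lemma of_vec_to_vec [simp]: "of_vec (to_vec x) = x"
  using euclidean_representation[of x] by (simp add: of_vec_def to_vec_def sum_coord_basis)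

lemma to_vec_of_vec [simp]: "to_vec (of_vec v) = v"
  by (simp add: of_vec_def to_vec_def vec_eq_iff inner_sum_left if_distrib cong: if_cong)

lemma linear_of_vec: "linear of_vec"
  by (rule linearI) (simp_all add: of_vec_def scaleR_left_distrib sum.distrib scaleR_sum_right)

lemma linear_to_vec: "linear to_vec"
  by (rule linearI) (simp_all add: to_vec_def vec_eq_iff inner_left_distrib)

lemma continuous_of_vec [continuous_intros]: "continuous_on S of_vec"
  by (simp add: linear_continuous_on linear_linear linear_of_vec)

lemma continuous_to_vec [continuous_intros]: "continuous_on S to_vec"
  by (simp add: linear_continuous_on linear_linear linear_to_vec)

text \<open>
  Boxes determine Lebesgue measure, and the isometry \<open>of_vec\<close> matches boxes with boxes of the same
  side lengths.
\<close>

lemma distr_of_vec: "distr lborel borel (of_vec :: real ^ 'a coord \<Rightarrow> 'a::euclidean_space) = lborel"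
proof (rule lborel_eqI[symmetric])
  fix l u :: 'a
  assume lu: "\<And>b. b \<in> Basis \<Longrightarrow> l \<bullet> b \<le> u \<bullet> b"
  have [measurable]: "(of_vec :: real ^ 'a coord \<Rightarrow> 'a) \<in> borel_measurable borel"
    by (intro borel_measurable_continuous_onI continuous_intros)
  have in_coord: "of_vec v \<bullet> coord_basis i = v $ i" for v :: "real ^ 'a coord" and i
    by (metis to_vec_of_vec to_vec_def vec_lambda_beta)
  have "of_vec -` box l u = box (to_vec l) (to_vec u)"
  proof -
    have range: "Basis = range (coord_basis :: 'a coord \<Rightarrow> 'a)"
      using bij_betw_coord_basis[where 'a = 'a] by (simp add: bij_betw_def)
    have "of_vec v \<in> box l u \<longleftrightarrow> v \<in> box (to_vec l) (to_vec u)" for v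
      unfolding mem_box range Basis_vec_def by (auto simp: in_coord to_vec_def inner_axis)
    then show ?thesis by blast
  qed
  then have "emeasure (distr lborel borel of_vec) (box l u)
      = emeasure lborel (box (to_vec l) (to_vec u))"
    by (simp add: emeasure_distr)
  also have "\<dots> = ennreal (\<Prod>b\<in>Basis. (to_vec u - to_vec l) \<bullet> b)"
    using lu by (subst emeasure_lborel_box) (auto simp: Basis_vec_def inner_axis to_vec_def)
  also have "(\<Prod>b\<in>Basis. (to_vec u - to_vec l) \<bullet> b) = (\<Prod>i\<in>UNIV. (u - l) \<bullet> coord_basis i)"
  proof -
    have "bij_betw (\<lambda>i. axis i 1 :: real ^ 'a coord) UNIV Basis"
      by (auto simp: bij_betw_def inj_on_def Basis_vec_def axis_eq_axis)
    then show ?thesis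
      by (subst prod.reindex_bij_betw[symmetric])
        (auto simp: inner_axis to_vec_def inner_diff_left)
  qed
  also have "\<dots> = (\<Prod>b\<in>Basis. (u - l) \<bullet> b)"
    by (simp add: prod_coord_basis)
  finally show "emeasure (distr lborel borel of_vec) (box l u) = (\<Prod>b\<in>Basis. (u - l) \<bullet> b)" .
qed simp

definition ldet :: "('a::euclidean_space \<Rightarrow> 'a) \<Rightarrow> real" where
  "ldet T = det (matrix (to_vec \<circ> T \<circ> of_vec))"

lemma linear_vec_conj: "linear T \<Longrightarrow> linear (to_vec \<circ> T \<circ> of_vec)"
  by (intro linear_compose linear_of_vec linear_to_vec)

lemma ldet_compose:
  assumes "linear S" "linear T"
  shows "ldet (S \<circ> T) = ldet S * ldet T"
proof -
  have "to_vec \<circ> (S \<circ> T) \<circ> of_vec = (to_vec \<circ> S \<circ> of_vec) \<circ> (to_vec \<circ> T \<circ> of_vec)"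
    by (simp add: fun_eq_iff)
  then show ?thesis
    unfolding ldet_def
    using matrix_compose[OF linear_vec_conj linear_vec_conj, OF assms(2,1)]
    by (simp add: det_mul)
qed

lemma ldet_id [simp]: "ldet (\<lambda>x. x) = 1"
proof -
  have "to_vec \<circ> (\<lambda>x. x) \<circ> of_vec = id"
    by (simp add: fun_eq_iff)
  then show ?thesis
    unfolding ldet_def by (metis matrix_id)
qed

lemma ldet_alt: "ldet T = det (\<chi> i j. T (coord_basis j) \<bullet> coord_basis i)"
proof -
  have "of_vec (axis j 1) = coord_basis j" for j :: "'a coord"
    by (simp add: of_vec_def axis_def if_distrib[of "\<lambda>c. c *\<^sub>R _"] cong: if_cong)
  then show ?thesis
    by (simp add: ldet_def matrix_def to_vec_def)
qed

lemma ldet_diagonal: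
  assumes "\<And>b. b \<in> Basis \<Longrightarrow> T b = d b *\<^sub>R b"
  shows "ldet T = (\<Prod>b\<in>Basis. d b)"
  by (subst ldet_alt, subst det_diagonal) (auto simp: assms prod_coord_basis)

lemma continuous_ldet:
  assumes "\<And>v. continuous_on X (\<lambda>x. W x v)"
  shows "continuous_on X (\<lambda>x. ldet (W x))"
  unfolding ldet_alt det_def by (auto intro!: continuous_intros assms)

text \<open>
  Change of variables for a diffeomorphism with Jacobian of constant modulus. It is used for the left
  translations in the exponential chart and for the reflection, where the modulus is 1, and for the
  dilations, where it is \<open>s powr Q\<close>. Testing on boxes suffices, since these determine Lebesgue measure.
\<close>

lemma emeasure_image_const_ldet:
  fixes f :: "'a::euclidean_space \<Rightarrow> 'a"
  assumes deriv: "\<And>x. (f has_derivative f' x) (at x)"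
    and "bij f" and cont: "continuous_on UNIV (inv f)"
    and ldet: "\<And>x. \<bar>ldet (f' x)\<bar> = c" and "c > 0"
    and S: "S \<in> sets borel"
  shows "emeasure lborel (f ` S) = ennreal c * emeasure lborel S"
proof -
  note inj = bij_is_inj[OF \<open>bij f\<close>] and surj = bij_is_surj[OF \<open>bij f\<close>]
  have [measurable]: "inv f \<in> borel_measurable borel"
    by (intro borel_measurable_continuous_onI cont)
  have vimage: "inv f -` T = f ` T" for T
    using inj surj by (simp add: bij_vimage_eq_inv_image bij_imp_bij_inv \<open>bij f\<close> inv_inv_eq)
  have f_borel: "f ` T \<in> sets borel" if "T \<in> sets borel" for T
    using measurable_sets[OF \<open>inv f \<in> borel_measurable borel\<close> that] by (simp add: vimage)
  have to_vec_meas[measurable]: "(of_vec :: _ \<Rightarrow> 'a) \<in> borel_measurable borel" "(to_vec :: 'a \<Rightarrow> _) \<in> borel_measurable borel"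
    by (rule borel_measurable_continuous_onI[OF continuous_of_vec] borel_measurable_continuous_onI[OF continuous_to_vec])+
  have em: "emeasure lborel T = emeasure lborel (to_vec ` T)" if "T \<in> sets borel" for T :: "'a set"
  proof -
    have "of_vec -` T = to_vec ` T"
      by (auto intro: image_eqI[where x = "of_vec _"])
    with that show ?thesis
      by (subst distr_of_vec[symmetric], subst emeasure_distr) auto
  qed
  have to_vec_borel: "to_vec ` T \<in> sets borel" if "T \<in> sets borel" for T :: "'a set"
  proof -
    have "of_vec -` T = to_vec ` T"
      by (auto intro: image_eqI[where x = "of_vec _"])
    then show ?thesis
      using measurable_sets[OF to_vec_meas(1) that] by simp
  qed
  have box: "emeasure lborel (f ` box l u) = ennreal c * emeasure lborel (box l u)" for l u :: 'a
  proof -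
    let ?g = "to_vec \<circ> f \<circ> of_vec" and ?B = "to_vec ` box l u"
    have B: "?B \<in> sets borel" "emeasure lborel ?B < \<infinity>"
      using em[of "box l u"] to_vec_borel emeasure_lborel_box_finite[of l u] by auto
    then have lm: "?B \<in> lmeasurable"
      by (simp add: fmeasurable_def)
    have eq: "?g ` ?B = to_vec ` f ` box l u"
      by (auto simp: image_image)
    have "?g ` ?B \<in> lmeasurable \<and> measure lebesgue (?g ` ?B) = c * measure lebesgue ?B"
    proof (subst has_measure_differentiable_image)
      show "?B \<in> sets lebesgue" using lm by (rule fmeasurableD)
      show "(?g has_derivative (to_vec \<circ> f' (of_vec v) \<circ> of_vec)) (at v within ?B)" for v
      proof (rule has_derivative_at_withinI)
        have "(f \<circ> of_vec has_derivative f' (of_vec v) \<circ> of_vec) (at v)"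
          by (rule diff_chain_at[OF linear_imp_has_derivative[OF linear_of_vec] deriv])
        from diff_chain_at[OF this linear_imp_has_derivative[OF linear_to_vec]]
        show "(?g has_derivative (to_vec \<circ> f' (of_vec v) \<circ> of_vec)) (at v)"
          by (simp only: o_assoc)
      qed
      show "inj_on ?g ?B"
      proof (rule inj_onI)
        fix v w assume "?g v = ?g w"
        then have "of_vec (?g v) = of_vec (?g w)" by (rule arg_cong)
        then have "of_vec v = of_vec w" using inj by (simp add: inj_eq)
        then show "v = w" by (metis to_vec_of_vec)
      qed
      show "((\<lambda>v. \<bar>det (matrix (to_vec \<circ> f' (of_vec v) \<circ> of_vec))\<bar>) has_integral c * measure lebesgue ?B) ?B"
        using has_integral_mult_right[OF integrable_integral[OF
            lmeasurable_iff_integrable_on[THEN iffD1, OF lm]], of c] ldet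
        by (simp add: ldet_def o_def lmeasure_integral[OF lm])
    qed
    then have "emeasure lebesgue (?g ` ?B) = ennreal c * emeasure lebesgue ?B"
      using lm \<open>c > 0\<close> by (simp add: emeasure_eq_measure2 ennreal_mult)
    moreover have "?g ` ?B \<in> sets borel"
      unfolding eq by (intro to_vec_borel f_borel) simp
    ultimately have "emeasure lborel (?g ` ?B) = ennreal c * emeasure lborel ?B"
      using B by simp
    then show ?thesis
      unfolding eq using em[of "f ` box l u"] em[of "box l u"] f_borel[of "box l u"] by simp
  qed
  have "lborel = scale_measure (1 / c) (distr lborel borel (inv f))"
  proof (rule lborel_eqI)
    fix l u :: 'a
    assume "\<And>b. b \<in> Basis \<Longrightarrow> l \<bullet> b \<le> u \<bullet> b"
    then show "emeasure (scale_measure (ennreal (1 / c)) (distr lborel borel (inv f))) (box l u)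
       = (\<Prod>b\<in>Basis. (u - l) \<bullet> b)"
      using \<open>c > 0\<close>
      by (simp add: emeasure_distr vimage box emeasure_lborel_box_eq mult.assoc[symmetric] ennreal_mult[symmetric])
  qed simp
  then have "emeasure lborel S
      = emeasure (scale_measure (1 / c) (distr lborel borel (inv f))) S"
    by (rule arg_cong)
  also have "\<dots> = ennreal (1 / c) * emeasure lborel (f ` S)"
    using S by (simp add: emeasure_distr vimage)
  finally have "ennreal c * emeasure lborel S = ennreal c * ennreal (1 / c) * emeasure lborel (f ` S)"
    by (simp add: mult.assoc)
  also have "ennreal c * ennreal (1 / c) = 1"
    using \<open>c > 0\<close> by (simp flip: ennreal_mult)
  finally show ?thesis
    by simp
qed

section \<open>The logarithmic derivative of the exponential map\<close>

text \<open>
  Turns an expression that is linear in a moving argument into a finite sum of products of scalar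
  functions with values at fixed vectors; the product rule applies to these one by one.
\<close>

lemma linear_sum_Basis:
  fixes f :: "'a::euclidean_space \<Rightarrow> 'b::real_vector"
  assumes "linear f"
  shows "f z = (\<Sum>b\<in>Basis. (z \<bullet> b) *\<^sub>R f b)"
  by (subst euclidean_representation[symmetric, of z], subst linear_sum[OF assms])
    (simp add: linear_scale[OF assms])

context exponential_lie_group
begin

definition chart_mult :: "'a \<Rightarrow> 'a \<Rightarrow> 'a" where
  "chart_mult x y = inv E (E x + E y)"

definition mult_deriv :: "'a \<times> 'a \<Rightarrow> 'a \<times> 'a \<Rightarrow> 'a" where
  "mult_deriv p = frechet_derivative (\<lambda>(x, y). inv E (E x + E y)) (at p)"

text \<open>
  The left logarithmic derivative of the exponential map: the derivative at \<open>x\<close> of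
  \<open>z \<mapsto> log (exp (- x) exp z)\<close>. Its determinant is the density of Haar measure in the exponential chart.
  In terms of the Lie bracket it is the power series \<open>(1 - exp (- ad x)) / ad x\<close>.
\<close>

definition log_deriv :: "'a \<Rightarrow> 'a \<Rightarrow> 'a" where
  "log_deriv x v = mult_deriv (- x, x) (0, v)"

lemma bij_E: "bij E"
  using exp_homeomorphism by (metis bij_betw_def homeomorphism_def inj_on_inverseI)

lemma E_inv [simp]: "E (inv E g) = g"
  using bij_E by (simp add: bij_is_surj surj_f_inv_f)

lemma inv_E [simp]: "inv E (E x) = x"
  using bij_E by (simp add: bij_is_inj)

lemma E_zero [simp]: "E 0 = 0"
  by (metis add.right_neutral add_left_cancel one_parameter scaleR_zero_left)

lemma E_minus: "E (- x) = - E x"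
  using one_parameter[of 1 "-1" x] by (simp add: minus_unique)

lemma E_chart_mult [simp]: "E (chart_mult x y) = E x + E y"
  by (simp add: chart_mult_def)

lemma chart_mult_zero [simp]: "chart_mult x 0 = x" "chart_mult 0 y = y"
  by (simp_all add: chart_mult_def)

lemma chart_mult_left_inverse [simp]: "chart_mult (- x) x = 0"
  by (metis E_minus E_zero chart_mult_def inv_E left_minus)

lemma has_derivative_mult: "((\<lambda>(x, y). chart_mult x y) has_derivative mult_deriv p) (at p)"
  and continuous_mult_deriv: "continuous_on UNIV (\<lambda>p. mult_deriv p v)"
  and differentiable_mult_deriv: "(\<lambda>p. mult_deriv p v) differentiable (at p)"
proof -
  let ?m = "\<lambda>(x, y). inv E (E x + E y)"
  have smooth: "n_times_differentiable n ?m" for n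
    using smooth_mult by (simp add: smooth_def)
  show "((\<lambda>(x, y). chart_mult x y) has_derivative mult_deriv p) (at p)"
    using smooth[of "Suc 0"] unfolding chart_mult_def mult_deriv_def
    by (cases p) (simp add: frechet_derivative_works)
  show "continuous_on UNIV (\<lambda>p. mult_deriv p v)"
    using smooth[of "Suc 0"] unfolding mult_deriv_def by (cases v) simp
  show "(\<lambda>p. mult_deriv p v) differentiable (at p)"
    using smooth[of "Suc (Suc 0)"] unfolding mult_deriv_def by (cases p, cases v) simp
qed

lemma linear_mult_deriv: "linear (mult_deriv p)"
  using has_derivative_mult has_derivative_linear by blast

text \<open>
  The one calculus rule for the group law; every derivative below is read off from it by inserting
  suitable curves.
\<close>

lemma mult_vector_derivative:
  assumes "(a has_vector_derivative a') (at t)" "(b has_vector_derivative b') (at t)"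
  shows "((\<lambda>t. chart_mult (a t) (b t)) has_vector_derivative mult_deriv (a t, b t) (a', b')) (at t)"
proof -
  have "((\<lambda>t. (a t, b t)) has_vector_derivative (a', b')) (at t)"
    using assms by (rule has_vector_derivative_Pair)
  from vector_derivative_diff_chain_within[OF this has_derivative_at_withinI[OF has_derivative_mult]]
  show ?thesis by (simp add: o_def)
qed

lemma mult_deriv_at_zero: "mult_deriv (0, 0) (v, w) = v + w"
proof -
  have *: "((\<lambda>t. t *\<^sub>R u) has_vector_derivative u) (at 0)" for u :: 'a
    by (auto intro!: derivative_eq_intros)
  have z: "((\<lambda>t. 0 :: 'a) has_vector_derivative 0) (at (0::real))"
    by simp
  have "mult_deriv (0, 0) (v, 0) = v"
    using mult_vector_derivative[OF *[of v] z]
    by (simp add: vector_derivative_unique_at[OF _ *[of v]])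
  moreover have "mult_deriv (0, 0) (0, w) = w"
    using mult_vector_derivative[OF z *[of w]]
    by (simp add: vector_derivative_unique_at[OF _ *[of w]])
  moreover have "mult_deriv (0, 0) (v, w) = mult_deriv (0, 0) (v, 0) + mult_deriv (0, 0) (0, w)"
    using linear_add[OF linear_mult_deriv, of _ "(v, 0)" "(0, w)"] by simp
  ultimately show ?thesis by simp
qed

text \<open>
  Conjugation written as two multiplications. The formula for \<open>Ad\<close> gives linearity in \<open>y\<close> and smooth
  dependence on \<open>x\<close>; the second part allows \<open>Ad\<close> to be computed along any curve through the identity,
  as is needed for the chain rule in \<open>Ad_add\<close>.
\<close>

lemma Ad_eq: "Ad E (E x) y = mult_deriv (x, - x) (mult_deriv (x, 0) (0, y), 0)"
  and Ad_curve: "v 0 = 0 \<Longrightarrow> (v has_vector_derivative y) (at 0) \<Longrightarrow>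
    ((\<lambda>t. inv E (g + E (v t) - g)) has_vector_derivative Ad E g y) (at 0)"
proof -
  have curve: "((\<lambda>t. inv E (E x + E (v t) - E x)) has_vector_derivative
      mult_deriv (x, - x) (mult_deriv (x, 0) (0, y), 0)) (at 0)"
    if "v 0 = 0" "(v has_vector_derivative y) (at 0)" for v :: "real \<Rightarrow> 'a" and x y
  proof -
    have "((\<lambda>t. chart_mult (chart_mult x (v t)) (- x)) has_vector_derivative
        mult_deriv (chart_mult x (v 0), - x) (mult_deriv (x, v 0) (0, y), 0)) (at 0)"
      by (intro mult_vector_derivative that has_vector_derivative_const)
    moreover have "chart_mult (chart_mult x w) (- x) = inv E (E x + E w - E x)" for w
      by (simp add: chart_mult_def E_minus)
    ultimately show ?thesis using that by simp
  qed
  have scale: "((\<lambda>t. t *\<^sub>R u) has_vector_derivative u) (at 0)" for u :: 'a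
    by (auto intro!: derivative_eq_intros)
  show eq: "Ad E (E x) y = mult_deriv (x, - x) (mult_deriv (x, 0) (0, y), 0)" for x y
    unfolding Ad_def by (rule vector_derivative_at, rule curve[OF _ scale]) simp
  show "((\<lambda>t. inv E (g + E (v t) - g)) has_vector_derivative Ad E g y) (at 0)"
    if "v 0 = 0" "(v has_vector_derivative y) (at 0)"
    using curve[OF that, of "inv E g"] eq[of "inv E g"] by simp
qed

lemma linear_Ad: "linear (Ad E g)"
proof -
  obtain x where g: "g = E x" by (metis E_inv)
  have "linear (\<lambda>v. (0, v) :: 'a \<times> 'a)" "linear (\<lambda>v. (v, 0) :: 'a \<times> 'a)"
    by (rule linearI; simp)+
  from linear_compose[OF linear_compose[OF linear_compose[OF this(1) linear_mult_deriv] this(2)]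
      linear_mult_deriv]
  show ?thesis
    by (simp add: g o_def Ad_eq[abs_def])
qed

lemma Ad_zero [simp]: "Ad E 0 y = y"
  using Ad_eq[of 0 y] by (simp add: mult_deriv_at_zero)

lemma Ad_add: "Ad E (g + h) y = Ad E g (Ad E h y)"
proof (rule vector_derivative_unique_at)
  let ?v = "\<lambda>t. inv E (h + E (t *\<^sub>R y) - h)"
  have scale: "((\<lambda>t. t *\<^sub>R y) has_vector_derivative y) (at 0)"
    by (auto intro!: derivative_eq_intros)
  have inv_zero: "inv E 0 = 0"
    by (metis E_zero inv_E)
  have v: "(?v has_vector_derivative Ad E h y) (at 0)"
    by (rule Ad_curve[OF _ scale]) simp
  show "((\<lambda>t. inv E (g + E (?v t) - g)) has_vector_derivative Ad E g (Ad E h y)) (at 0)"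
    by (rule Ad_curve[OF _ v]) (simp add: inv_zero)
  have "g + E (?v t) - g = g + h + E (t *\<^sub>R y) - (g + h)" for t
    by (simp add: group_add_class.diff_conv_add_uminus minus_add add.assoc del: add_uminus_conv_diff)
  then show "((\<lambda>t. inv E (g + E (?v t) - g)) has_vector_derivative Ad E (g + h) y) (at 0)"
    using Ad_curve[OF _ scale, of "g + h"] by simp
qed

lemma Ad_one_parameter: "Ad E (E ((s + t) *\<^sub>R x)) y = Ad E (E (s *\<^sub>R x)) (Ad E (E (t *\<^sub>R x)) y)"
  by (simp add: one_parameter Ad_add)

lemma differentiable_mult_deriv_curve:
  assumes "a differentiable (at t)" "b differentiable (at t)" "v differentiable (at t)" "w differentiable (at t)"
  shows "(\<lambda>t :: real. mult_deriv (a t, b t) (v t, w t)) differentiable (at t)"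
proof -
  have comp: "(\<lambda>t. mult_deriv (a t, b t) e) differentiable (at t)" for e
  proof -
    have "((\<lambda>p. mult_deriv p e) \<circ> (\<lambda>t. (a t, b t))) differentiable (at t)"
      by (intro differentiable_chain_at differentiable_mult_deriv differentiable_Pair assms)
    then show ?thesis by (simp add: o_def)
  qed
  have "mult_deriv (a t, b t) (v t, w t)
      = (\<Sum>e\<in>Basis. ((v t, w t) \<bullet> e) *\<^sub>R mult_deriv (a t, b t) e)" for t
    by (subst euclidean_representation[symmetric, of "(v t, w t)"],
        subst linear_sum[OF linear_mult_deriv], subst linear_scale[OF linear_mult_deriv]) simp
  moreover have "(\<lambda>t. \<Sum>e\<in>Basis. ((v t, w t) \<bullet> e) *\<^sub>R mult_deriv (a t, b t) e) differentiable (at t)"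
    by (intro differentiable_sum finite_Basis ballI differentiable_scaleR comp differentiable_inner
        differentiable_Pair differentiable_const assms)
  ultimately show ?thesis by presburger
qed

lemma lie_bracket_derivative:
  "((\<lambda>s. Ad E (E (s *\<^sub>R x)) y) has_vector_derivative lie_bracket E x y) (at 0)"
proof -
  have "(\<lambda>s. Ad E (E (s *\<^sub>R x)) y) differentiable (at 0)"
    unfolding Ad_eq
    by (intro differentiable_mult_deriv_curve differentiable_minus differentiable_scaleR
        differentiable_const differentiable_ident)
  then show ?thesis
    unfolding lie_bracket_def by (simp add: vector_derivative_works)
qed

text \<open>
  \<open>s \<mapsto> Ad (exp (s x))\<close> is a one-parameter group of linear maps whose generator is \<open>ad x\<close>. Splitting
  off the increment on the left or on the right gives the two forms of its differential equation.
\<close>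

lemma Ad_derivative:
  "((\<lambda>s. Ad E (E (s *\<^sub>R x)) y) has_vector_derivative lie_bracket E x (Ad E (E (s *\<^sub>R x)) y)) (at s)"
  "((\<lambda>s. Ad E (E (s *\<^sub>R x)) y) has_vector_derivative Ad E (E (s *\<^sub>R x)) (lie_bracket E x y)) (at s)"
proof -
  have shift: "((\<lambda>r. f (r - s)) has_vector_derivative f') (at s)"
    if "(f has_vector_derivative f') (at 0)" for f :: "real \<Rightarrow> 'a" and f'
  proof -
    have "((\<lambda>r. r - s) has_vector_derivative 1) (at s)"
      by (auto intro!: derivative_eq_intros)
    from vector_diff_chain_at[OF this, of f f'] that show ?thesis
      by (simp add: o_def)
  qed
  show "((\<lambda>s. Ad E (E (s *\<^sub>R x)) y) has_vector_derivative lie_bracket E x (Ad E (E (s *\<^sub>R x)) y)) (at s)"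
    using shift[OF lie_bracket_derivative[of x "Ad E (E (s *\<^sub>R x)) y"]]
    by (simp flip: Ad_one_parameter)
  have "((\<lambda>u. Ad E (E (s *\<^sub>R x)) (Ad E (E (u *\<^sub>R x)) y)) has_vector_derivative
      Ad E (E (s *\<^sub>R x)) (lie_bracket E x y)) (at 0)"
    by (intro bounded_linear.has_vector_derivative[OF _ lie_bracket_derivative] linear_linear[THEN iffD2] linear_Ad)
  from shift[OF this]
  show "((\<lambda>s. Ad E (E (s *\<^sub>R x)) y) has_vector_derivative Ad E (E (s *\<^sub>R x)) (lie_bracket E x y)) (at s)"
    by (simp flip: Ad_one_parameter)
qed

lemma linear_lie_bracket: "linear (lie_bracket E x)"
proof (rule linearI)
  show "lie_bracket E x (y + z) = lie_bracket E x y + lie_bracket E x z" for y z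
    using has_vector_derivative_add[OF lie_bracket_derivative[of x y] lie_bracket_derivative[of x z]]
      lie_bracket_derivative[of x "y + z"]
    by (simp add: linear_add[OF linear_Ad] vector_derivative_unique_at)
  show "lie_bracket E x (r *\<^sub>R y) = r *\<^sub>R lie_bracket E x y" for r y
    using bounded_linear.has_vector_derivative[OF bounded_linear_scaleR_right lie_bracket_derivative[of x y], of r]
      lie_bracket_derivative[of x "r *\<^sub>R y"]
    by (simp add: linear_scale[OF linear_Ad] vector_derivative_unique_at)
qed

text \<open>
  Both \<open>s \<mapsto> T (Ad (exp (s x)) y)\<close> and \<open>s \<mapsto> Ad (exp (s (T x))) (T y)\<close> solve the linear equation
  \<open>z' = [T x, z]\<close> with initial value \<open>T y\<close>, so they agree. The uniqueness argument transports the first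
  solution back by the flow \<open>Ad (exp (- s (T x)))\<close> and shows that the outcome is constant.
\<close>

lemma Ad_morphism:
  assumes "lie_algebra_morphism E T"
  shows "T (Ad E (E x) y) = Ad E (E (T x)) (T y)"
proof -
  have T: "linear T" and bracket: "T (lie_bracket E x y) = lie_bracket E (T x) (T y)" for x y
    using assms unfolding lie_algebra_morphism_def by blast+
  define z where "z s = T (Ad E (E (s *\<^sub>R x)) y)" for s
  define c where "c s = Ad E (E (s *\<^sub>R (- T x))) (z s)" for s
  have z': "(z has_vector_derivative lie_bracket E (T x) (z s)) (at s)" for s
    using bounded_linear.has_vector_derivative[OF linear_linear[THEN iffD2, OF T] Ad_derivative(1)[of x y s]]
    by (simp add: z_def[abs_def] bracket)
  have neg: "((\<lambda>s. Ad E (E (s *\<^sub>R (- u))) w) has_vector_derivative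
      - Ad E (E (s *\<^sub>R (- u))) (lie_bracket E u w)) (at s)" for u w s
  proof -
    have "((\<lambda>r::real. - r) has_vector_derivative - 1) (at s)"
      by (auto intro!: derivative_eq_intros)
    from vector_diff_chain_at[OF this Ad_derivative(2)] show ?thesis
      by (simp add: o_def)
  qed
  have c': "(c has_vector_derivative 0) (at s)" for s
  proof -
    \<comment> \<open>The flow and the vector that it is applied to both move with \<open>s\<close>: expand in \<open>Basis\<close> and
      use the product rule in every summand.\<close>
    have "((\<lambda>s. \<Sum>b\<in>Basis. (z s \<bullet> b) *\<^sub>R Ad E (E (s *\<^sub>R (- T x))) b) has_vector_derivative
        (\<Sum>b\<in>Basis. (z s \<bullet> b) *\<^sub>R - Ad E (E (s *\<^sub>R (- T x))) (lie_bracket E (T x) b)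
          + (lie_bracket E (T x) (z s) \<bullet> b) *\<^sub>R Ad E (E (s *\<^sub>R (- T x))) b)) (at s)"
      by (intro has_vector_derivative_sum has_vector_derivative_scaleR neg
         has_real_derivative_iff_has_vector_derivative[THEN iffD2]
          bounded_linear.has_vector_derivative[OF bounded_linear_inner_left z'])
    also have "(\<lambda>s. \<Sum>b\<in>Basis. (z s \<bullet> b) *\<^sub>R Ad E (E (s *\<^sub>R (- T x))) b) = c"
      unfolding c_def by (intro ext linear_sum_Basis[OF linear_Ad, symmetric])
    also have "(\<Sum>b\<in>Basis. (z s \<bullet> b) *\<^sub>R - Ad E (E (s *\<^sub>R (- T x))) (lie_bracket E (T x) b)
          + (lie_bracket E (T x) (z s) \<bullet> b) *\<^sub>R Ad E (E (s *\<^sub>R (- T x))) b)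
        = - Ad E (E (s *\<^sub>R (- T x))) (lie_bracket E (T x) (z s))
          + Ad E (E (s *\<^sub>R (- T x))) (lie_bracket E (T x) (z s))"
    proof -
      have "Ad E g (lie_bracket E (T x) (z s)) = (\<Sum>b\<in>Basis. (z s \<bullet> b) *\<^sub>R Ad E g (lie_bracket E (T x) b))"
        and "Ad E g (lie_bracket E (T x) (z s)) = (\<Sum>b\<in>Basis. (lie_bracket E (T x) (z s) \<bullet> b) *\<^sub>R Ad E g b)"
        for g
        by (rule linear_sum_Basis[OF linear_compose[OF linear_lie_bracket linear_Ad], unfolded o_def],
            rule linear_sum_Basis[OF linear_Ad])
      then show ?thesis
        by (simp only: sum.distrib scaleR_minus_right sum_negf)
    qed
    finally show ?thesis by simp
  qed
  obtain c0 where "c s = c0" for s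
    using has_vector_derivative_zero_constant[of UNIV c] c' by auto
  then have "c 1 = c 0"
    by simp
  then have "Ad E (E (T x)) (Ad E (E (- T x)) (T (Ad E (E x) y))) = Ad E (E (T x)) (T y)"
    by (simp add: c_def z_def)
  then show ?thesis
    by (simp flip: Ad_add add: E_minus)
qed

lemma log_deriv_zero [simp]: "log_deriv 0 v = v"
  by (simp add: log_deriv_def mult_deriv_at_zero)

lemma linear_log_deriv: "linear (log_deriv x)"
proof -
  have "linear (\<lambda>v. (0, v) :: 'a \<times> 'a)"
    by (rule linearI) auto
  from linear_compose[OF this linear_mult_deriv[of "(- x, x)"]] show ?thesis
    by (simp add: o_def log_deriv_def[abs_def])
qed

lemma continuous_log_deriv: "continuous_on UNIV (\<lambda>x. log_deriv x v)"
  unfolding log_deriv_def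
  by (rule continuous_on_compose2[OF continuous_mult_deriv]) (auto intro!: continuous_intros)

lemma log_deriv_curve:
  "((\<lambda>s. chart_mult (- x) (x + s *\<^sub>R v)) has_vector_derivative log_deriv x v) (at 0)"
proof -
  have "((\<lambda>s. x + s *\<^sub>R v) has_vector_derivative v) (at 0)"
    by (auto intro!: derivative_eq_intros)
  from mult_vector_derivative[OF has_vector_derivative_const this] show ?thesis
    by (simp add: log_deriv_def)
qed

text \<open>
  Differentiate, at \<open>s = 0\<close>, the factorisation
  \<open>exp (- (t + u) x) exp ((t + u) (x + s y)) =\<close>
  \<open> exp (- t x) [exp (- u x) exp (u (x + s y))] exp (t x) \<cdot> exp (- t x) exp (t (x + s y))\<close>.
  The right-hand side is a product of two curves through the identity, so its derivative is the sum of
  theirs.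
\<close>

lemma log_deriv_cocycle:
  "log_deriv ((t + u) *\<^sub>R x) ((t + u) *\<^sub>R y)
     = Ad E (E (- t *\<^sub>R x)) (log_deriv (u *\<^sub>R x) (u *\<^sub>R y)) + log_deriv (t *\<^sub>R x) (t *\<^sub>R y)"
proof (rule vector_derivative_unique_at)
  define q where "q t s = chart_mult (- (t *\<^sub>R x)) (t *\<^sub>R x + s *\<^sub>R t *\<^sub>R y)" for t s :: real
  have q': "(q t has_vector_derivative log_deriv (t *\<^sub>R x) (t *\<^sub>R y)) (at 0)" for t
    unfolding q_def by (rule log_deriv_curve)
  have q0: "q t 0 = 0" for t
    by (simp add: q_def)
  have Eq: "E (q t s) = - E (t *\<^sub>R x) + E (t *\<^sub>R (x + s *\<^sub>R y))" for t s
    by (simp add: q_def E_minus scaleR_add_right mult.commute)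
  let ?g = "E (- t *\<^sub>R x)"
  have "E (q (t + u) s) = ?g + E (q u s) - ?g + E (q t s)" for s
  proof -
    have "E ((t + u) *\<^sub>R w) = E (u *\<^sub>R w) + E (t *\<^sub>R w)" for w
      by (metis add.commute one_parameter)
    then show ?thesis
      by (simp add: Eq E_minus minus_add add.assoc del: add_uminus_conv_diff flip: add_uminus_conv_diff)
  qed
  then have "q (t + u) s = chart_mult (inv E (?g + E (q u s) - ?g)) (q t s)" for s
    by (metis E_inv chart_mult_def inv_E)
  moreover have "((\<lambda>s. chart_mult (inv E (?g + E (q u s) - ?g)) (q t s)) has_vector_derivative
      Ad E ?g (log_deriv (u *\<^sub>R x) (u *\<^sub>R y)) + log_deriv (t *\<^sub>R x) (t *\<^sub>R y)) (at 0)"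
  proof -
    have "inv E 0 = 0" by (metis E_zero inv_E)
    then show ?thesis
      using mult_vector_derivative[OF Ad_curve[where g = ?g, OF q0[of u] q'[of u]] q'[of t]]
      by (simp add: q0 mult_deriv_at_zero)
  qed
  ultimately show "(q (t + u) has_vector_derivative
      Ad E ?g (log_deriv (u *\<^sub>R x) (u *\<^sub>R y)) + log_deriv (t *\<^sub>R x) (t *\<^sub>R y)) (at 0)"
    by presburger
  show "(q (t + u) has_vector_derivative log_deriv ((t + u) *\<^sub>R x) ((t + u) *\<^sub>R y)) (at 0)"
    by (rule q')
qed

text \<open>
  By the cocycle identity the derivative at \<open>t\<close> is \<open>Ad (exp (- t x))\<close> applied to the derivative at \<open>0\<close>,
  and the latter is \<open>y\<close>. In integrated form, \<open>log_deriv x y\<close> is the mean of \<open>Ad (exp (- t x)) y\<close> over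
  \<open>0 \<le> t \<le> 1\<close>.
\<close>

lemma log_deriv_derivative:
  "((\<lambda>t. log_deriv (t *\<^sub>R x) (t *\<^sub>R y)) has_vector_derivative Ad E (E (- t *\<^sub>R x)) y) (at t)"
proof -
  let ?\<omega> = "\<lambda>t. log_deriv (t *\<^sub>R x) (t *\<^sub>R y)"
  have at_zero: "(?\<omega> has_vector_derivative y) (at 0)"
  proof -
    have "(\<lambda>t. log_deriv (t *\<^sub>R x) y) differentiable (at 0)"
      unfolding log_deriv_def
      by (intro differentiable_mult_deriv_curve differentiable_minus differentiable_scaleR
          differentiable_const differentiable_ident)
    then obtain D where D: "((\<lambda>t. log_deriv (t *\<^sub>R x) y) has_vector_derivative D) (at 0)"
      using vector_derivative_works by blast
    have "((\<lambda>t. t *\<^sub>R log_deriv (t *\<^sub>R x) y) has_vector_derivative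
        0 *\<^sub>R D + 1 *\<^sub>R log_deriv (0 *\<^sub>R x) y) (at 0)"
      by (rule has_vector_derivative_scaleR[OF _ D]) (auto intro!: derivative_eq_intros)
    then show ?thesis
      by (simp add: linear_scale[OF linear_log_deriv])
  qed
  have "((\<lambda>u. Ad E (E (- t *\<^sub>R x)) (?\<omega> u) + ?\<omega> t) has_vector_derivative Ad E (E (- t *\<^sub>R x)) y + 0) (at 0)"
    by (intro has_vector_derivative_add has_vector_derivative_const
        bounded_linear.has_vector_derivative[OF _ at_zero] linear_linear[THEN iffD2] linear_Ad)
  then have "((\<lambda>u. ?\<omega> (t + u)) has_vector_derivative Ad E (E (- t *\<^sub>R x)) y) (at (t - t))"
    unfolding log_deriv_cocycle by simp
  moreover have "((\<lambda>r. r - t) has_vector_derivative 1) (at t)"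
    by (auto intro!: derivative_eq_intros)
  ultimately show ?thesis
    using vector_diff_chain_at[of "\<lambda>r. r - t" 1 t "\<lambda>u. ?\<omega> (t + u)" "Ad E (E (- t *\<^sub>R x)) y"]
    by (simp add: o_def)
qed

text \<open>
  With \<open>t x\<close> and \<open>t y\<close> in place of \<open>x\<close> and \<open>y\<close>, both sides vanish at \<open>t = 0\<close> and have the same derivative by \<open>Ad_morphism\<close>.
\<close>

lemma log_deriv_morphism:
  assumes "lie_algebra_morphism E T"
  shows "T (log_deriv x y) = log_deriv (T x) (T y)"
proof -
  have T: "linear T"
    using assms by (auto simp: lie_algebra_morphism_def)
  let ?d = "\<lambda>t. T (log_deriv (t *\<^sub>R x) (t *\<^sub>R y)) - log_deriv (t *\<^sub>R T x) (t *\<^sub>R T y)"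
  have "(?d has_vector_derivative
      T (Ad E (E (- t *\<^sub>R x)) y) - Ad E (E (- t *\<^sub>R T x)) (T y)) (at t)" for t
    by (intro has_vector_derivative_diff log_deriv_derivative
        bounded_linear.has_vector_derivative[OF _ log_deriv_derivative] linear_linear[THEN iffD2] T)
  moreover have "T (Ad E (E (- t *\<^sub>R x)) y) = Ad E (E (- t *\<^sub>R T x)) (T y)" for t
    using Ad_morphism[OF assms, of "- t *\<^sub>R x" y] by (simp add: linear_scale[OF T] linear_neg[OF T])
  ultimately have "(?d has_vector_derivative 0) (at t)" for t
    by simp
  then obtain c where "?d t = c" for t
    using has_vector_derivative_zero_constant[of UNIV ?d] by auto
  from this[of 1] this[of 0] have "?d 1 = ?d 0"
    by simp
  then show ?thesis
    by (simp add: linear_0[OF T])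
qed

lemma translation_derivative:
  "((\<lambda>y. inv E (g + E y)) has_derivative (\<lambda>v. mult_deriv (inv E g, y) (0, v))) (at y)"
proof -
  have "((\<lambda>y. (inv E g, y)) has_derivative (\<lambda>v. (0, v))) (at y)"
    by (auto intro!: derivative_eq_intros)
  from diff_chain_at[OF this has_derivative_mult] show ?thesis
    by (simp add: o_def chart_mult_def)
qed

text \<open>
  Left translation by \<open>g\<close> cancels in \<open>(g exp y)\<inverse> (g exp w) = exp (- y) exp w\<close>. Hence the Jacobian of a
  translation is the quotient of the values of the density at \<open>y\<close> and at its image.
\<close>

lemma log_deriv_translation:
  "log_deriv (inv E (g + E y)) (mult_deriv (inv E g, y) (0, v)) = log_deriv y v"
proof (rule vector_derivative_unique_at)
  let ?z = "inv E (g + E y)"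
  have "((\<lambda>s. y + s *\<^sub>R v) has_vector_derivative v) (at 0)"
    by (auto intro!: derivative_eq_intros)
  from mult_vector_derivative[OF has_vector_derivative_const[of "- ?z"]
    mult_vector_derivative[OF has_vector_derivative_const[of "inv E g"] this]]
  have "((\<lambda>s. chart_mult (- ?z) (chart_mult (inv E g) (y + s *\<^sub>R v))) has_vector_derivative
      log_deriv ?z (mult_deriv (inv E g, y) (0, v))) (at 0)"
    by (simp add: log_deriv_def chart_mult_def)
  moreover have "chart_mult (- ?z) (chart_mult (inv E g) w) = chart_mult (- y) w" for w
  proof -
    have "- (g + E y) + (g + E w) = - E y + (- g + g) + E w"
      by (simp only: minus_add add.assoc)
    then show ?thesis
      by (simp add: chart_mult_def E_minus)
  qed
  ultimately show "((\<lambda>s. chart_mult (- y) (y + s *\<^sub>R v)) has_vector_derivative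
      log_deriv ?z (mult_deriv (inv E g, y) (0, v))) (at 0)"
    by simp
qed (rule log_deriv_curve)

end

section \<open>Dilations\<close>

definition diag :: "('a::euclidean_space \<Rightarrow> real) \<Rightarrow> 'a \<Rightarrow> 'a" where
  "diag d x = (\<Sum>b\<in>Basis. (d b * (x \<bullet> b)) *\<^sub>R b)"

lemma linear_diag: "linear (diag d)"
  by (rule linearI) (simp_all add: diag_def inner_left_distrib distrib_left scaleR_left_distrib
      sum.distrib scaleR_sum_right mult.left_commute)

lemma diag_Basis: "b \<in> Basis \<Longrightarrow> diag d b = d b *\<^sub>R b"
  unfolding diag_def by (subst sum.remove[of _ b]) (auto simp: inner_Basis intro!: sum.neutral split: if_splits)

lemma diag_inner: "b \<in> Basis \<Longrightarrow> diag d x \<bullet> b = d b * (x \<bullet> b)"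
  unfolding diag_def inner_sum_left
  by (subst sum.remove[of _ b]) (auto simp: inner_Basis intro!: sum.neutral split: if_splits)

lemma ldet_conj:
  fixes P P' D :: "'a::euclidean_space \<Rightarrow> 'a"
  assumes "linear P" "linear P'" "linear D" and inv: "\<And>x. P' (P x) = x" "\<And>x. P (P' x) = x"
  shows "ldet (\<lambda>x. P (D (P' x))) = ldet D"
proof -
  have "ldet (P \<circ> (D \<circ> P')) = ldet P * (ldet D * ldet P')"
    using assms by (simp add: ldet_compose linear_compose)
  also have "ldet P * ldet P' = 1"
    using ldet_compose[OF assms(1,2)] by (simp add: o_def inv)
  then have "ldet P * (ldet D * ldet P') = ldet D"
    by (metis mult.left_commute mult.right_neutral)
  finally show ?thesis by (simp add: o_def)
qed

text \<open>
  Makes the trace of a diagonalisable operator equal to the sum of its eigenvalues, although the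
  eigenvectors need not be orthogonal.
\<close>

lemma operator_trace_compose_commute:
  fixes S T :: "'a::euclidean_space \<Rightarrow> 'a"
  assumes "linear S" "linear T"
  shows "operator_trace (\<lambda>x. S (T x)) = operator_trace (\<lambda>x. T (S x))"
proof -
  have expand: "operator_trace (\<lambda>x. X (Y x)) = (\<Sum>b\<in>Basis. \<Sum>c\<in>Basis. (Y b \<bullet> c) * (X c \<bullet> b))"
    if "linear X" for X Y :: "'a \<Rightarrow> 'a"
    unfolding operator_trace_def
  proof (rule sum.cong[OF refl])
    fix b :: 'a
    have "X (Y b) = (\<Sum>c\<in>Basis. (Y b \<bullet> c) *\<^sub>R X c)"
      by (rule linear_sum_Basis[OF that])
    then show "X (Y b) \<bullet> b = (\<Sum>c\<in>Basis. (Y b \<bullet> c) * (X c \<bullet> b))"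
      by (simp add: inner_sum_left)
  qed
  show ?thesis
    unfolding expand[OF assms(1)] expand[OF assms(2)]
    by (subst sum.swap) (simp add: mult.commute)
qed

lemma diagonalisable_positiveE:
  fixes A :: "'a::euclidean_space \<Rightarrow> 'a"
  assumes "diagonalisable_positive A"
  obtains P P' :: "'a \<Rightarrow> 'a" and w where "linear P" "linear P'"
    "\<forall>x. P' (P x) = x" "\<forall>x. P (P' x) = x" "\<forall>b\<in>Basis. 0 < w b \<and> A (P b) = w b *\<^sub>R P b"
proof -
  obtain B where B: "independent B" "span B = UNIV" and eig: "\<forall>b\<in>B. \<exists>c>0. A b = c *\<^sub>R b"
    using assms by (auto simp: diagonalisable_positive_def)
  have "finite B" using B(1) independent_bound by blast
  moreover have "card B = DIM('a)"
    using dim_eq_card_independent[OF B(1)] B(2) by (metis dim_UNIV dim_span)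
  ultimately obtain e :: "'a \<Rightarrow> 'a" where e: "bij_betw e Basis B"
    using finite_same_card_bij[of "Basis :: 'a set" B] by auto
  define P where "P x = (\<Sum>b\<in>Basis. (x \<bullet> b) *\<^sub>R e b)" for x
  have P: "linear P"
    by (rule linearI) (simp_all add: P_def inner_left_distrib scaleR_left_distrib sum.distrib scaleR_sum_right)
  have Pb: "P b = e b" if "b \<in> Basis" for b
    unfolding P_def using that by (subst sum.remove[of _ b]) (auto simp: inner_Basis intro!: sum.neutral split: if_splits)
  have "B \<subseteq> range P"
  proof
    fix y assume "y \<in> B"
    then obtain b where "b \<in> Basis" "y = e b"
      using e by (auto simp: bij_betw_def)
    then show "y \<in> range P"
      by (metis Pb rangeI)
  qed
  then have "surj P"
    using B(2) span_minimal[of B "range P"] linear_subspace_image[OF P subspace_UNIV] by auto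
  then obtain P' where P': "linear P'" "\<forall>x. P' (P x) = x" "\<forall>x. P (P' x) = x"
    using linear_surjective_isomorphism[OF P \<open>surj P\<close>] by auto
  have "\<forall>b\<in>Basis. \<exists>c>0. A (P b) = c *\<^sub>R P b"
    using eig e Pb by (auto simp: bij_betw_def)
  then obtain w where "\<forall>b\<in>Basis. 0 < w b \<and> A (P b) = w b *\<^sub>R P b"
    by metis
  with P P' show ?thesis
    by (rule that)
qed

lemma dilation_eigenvector:
  fixes v :: "'a::banach"
  assumes A: "linear A" and v: "A v = w *\<^sub>R v" and s: "0 < s"
  shows "dilation A s v = s powr w *\<^sub>R v"
proof -
  have pow: "(A ^^ k) v = w ^ k *\<^sub>R v" for k
    by (induction k) (simp_all add: linear_scale[OF A] v)
  have "(\<lambda>k. (ln s * w) ^ k /\<^sub>R fact k) sums exp (ln s * w)"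
    by (rule exp_converges)
  then have "(\<lambda>k. ((ln s * w) ^ k /\<^sub>R fact k) *\<^sub>R v) sums (exp (ln s * w) *\<^sub>R v)"
    by (rule sums_scaleR_left)
  moreover have "((ln s * w) ^ k /\<^sub>R fact k) *\<^sub>R v = (ln s ^ k / fact k) *\<^sub>R (A ^^ k) v" for k
    by (simp add: pow power_mult_distrib divide_inverse mult_ac)
  ultimately show ?thesis
    using s by (simp add: dilation_def sums_iff powr_def mult.commute)
qed

context homogeneous_group
begin

text \<open>
  On an eigenvector the exponential series of \<open>ln s\<close> times \<open>A\<close> is the series of a real exponential, and
  a linear map is determined by its values on the eigenbasis that \<open>P\<close> makes out of \<open>Basis\<close>.
\<close>

lemma dilation_diagonal:
  obtains P P' :: "'a \<Rightarrow> 'a" and w where "linear P" "linear P'"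
    "\<forall>x. P' (P x) = x" "\<forall>x. P (P' x) = x" "\<forall>b\<in>Basis. 0 < w b"
    "\<forall>s>0. \<forall>x. dilation A s x = P (diag (\<lambda>b. s powr w b) (P' x))"
    "operator_trace A = (\<Sum>b\<in>Basis. w b)"
proof -
  obtain P P' :: "'a \<Rightarrow> 'a" and w where P: "linear P" "linear P'"
    "\<forall>x. P' (P x) = x" "\<forall>x. P (P' x) = x"
    and w: "\<forall>b\<in>Basis. 0 < w b \<and> A (P b) = w b *\<^sub>R P b"
    by (rule diagonalisable_positiveE[OF generator])
  have A: "linear A"
    using generator by (simp add: diagonalisable_positive_def)
  have on_basis: "f x = P (diag d (P' x))"
    if "linear f" "\<And>b. b \<in> Basis \<Longrightarrow> f (P b) = d b *\<^sub>R P b" for f d x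
  proof -
    have "f (P (P' x)) = (\<Sum>b\<in>Basis. (P' x \<bullet> b) *\<^sub>R f (P b))"
      by (rule linear_sum_Basis[OF linear_compose[OF P(1) that(1)], unfolded o_def])
    also have "\<dots> = (\<Sum>b\<in>Basis. (P' x \<bullet> b) *\<^sub>R P (diag d b))"
      by (intro sum.cong refl) (simp add: that(2) diag_Basis linear_scale[OF P(1)])
    also have "\<dots> = P (diag d (P' x))"
      by (rule linear_sum_Basis[OF linear_compose[OF linear_diag P(1)], unfolded o_def, symmetric])
    finally show ?thesis by (simp add: P)
  qed
  have "dilation A s x = P (diag (\<lambda>b. s powr w b) (P' x))" if s: "0 < s" for s x
  proof (rule on_basis)
    show "linear (dilation A s)"
      using dilation_morphism[OF s] by (simp add: lie_algebra_morphism_def)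
    show "dilation A s (P b) = s powr w b *\<^sub>R P b" if "b \<in> Basis" for b
      using A w that s by (intro dilation_eigenvector) auto
  qed
  moreover have "operator_trace A = (\<Sum>b\<in>Basis. w b)"
  proof -
    have "A = (\<lambda>x. P (diag w (P' x)))"
      using on_basis[OF A, of w] w by blast
    then have "operator_trace A = operator_trace (\<lambda>x. P ((diag w \<circ> P') x))"
      by (simp add: o_def)
    also have "\<dots> = operator_trace (diag w)"
      using P by (subst operator_trace_compose_commute) (simp_all add: linear_compose linear_diag)
    also have "\<dots> = (\<Sum>b\<in>Basis. w b)"
      by (simp add: operator_trace_def diag_inner)
    finally show ?thesis .
  qed
  ultimately show ?thesis
    using that[of P P' w] P w by blast
qed

lemma linear_dilation: "0 < s \<Longrightarrow> linear (dilation A s)"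
  using dilation_morphism by (simp add: lie_algebra_morphism_def)

lemma dilation_inverse: "0 < s \<Longrightarrow> dilation A (1 / s) (dilation A s x) = x"
proof -
  assume s: "0 < s"
  obtain P P' :: "'a \<Rightarrow> 'a" and w where P: "linear P" "linear P'" "\<forall>x. P' (P x) = x" "\<forall>x. P (P' x) = x"
    and w: "\<forall>b\<in>Basis. 0 < w b"
    and D: "\<forall>s>0. \<forall>x. dilation A s x = P (diag (\<lambda>b. s powr w b) (P' x))"
    and trace: "operator_trace A = (\<Sum>b\<in>Basis. w b)"
    by (rule dilation_diagonal)
  have "diag (\<lambda>b. (1 / s) powr w b) (diag (\<lambda>b. s powr w b) y) = y" for y
    by (rule euclidean_eqI) (use s in \<open>simp add: diag_inner powr_divide\<close>)
  then show ?thesis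
    using s by (simp add: D P)
qed

lemma ldet_dilation: "0 < s \<Longrightarrow> ldet (dilation A s) = s powr operator_trace A"
proof -
  assume s: "0 < s"
  obtain P P' :: "'a \<Rightarrow> 'a" and w where P: "linear P" "linear P'" "\<forall>x. P' (P x) = x" "\<forall>x. P (P' x) = x"
    and w: "\<forall>b\<in>Basis. 0 < w b"
    and D: "\<forall>s>0. \<forall>x. dilation A s x = P (diag (\<lambda>b. s powr w b) (P' x))"
    and trace: "operator_trace A = (\<Sum>b\<in>Basis. w b)"
    by (rule dilation_diagonal)
  have "dilation A s = (\<lambda>x. P (diag (\<lambda>b. s powr w b) (P' x)))"
    using D s by blast
  then have "ldet (dilation A s) = ldet (diag (\<lambda>b. s powr w b))"
    using P by (simp add: ldet_conj linear_diag)
  also have "\<dots> = (\<Prod>b\<in>Basis. s powr w b)"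
    by (rule ldet_diagonal) (simp add: diag_Basis)
  also have "\<dots> = s powr operator_trace A"
    using s by (simp add: trace powr_sum)
  finally show ?thesis .
qed

lemma continuous_dilation: "continuous_on {0<..} (\<lambda>s. dilation A s x)"
  and dilation_tendsto_zero: "((\<lambda>s. dilation A s x) \<longlongrightarrow> 0) (at_right 0)"
proof -
  obtain P P' :: "'a \<Rightarrow> 'a" and w where P: "linear P" "linear P'" "\<forall>x. P' (P x) = x" "\<forall>x. P (P' x) = x"
    and w: "\<forall>b\<in>Basis. 0 < w b"
    and D: "\<forall>s>0. \<forall>x. dilation A s x = P (diag (\<lambda>b. s powr w b) (P' x))"
    and trace: "operator_trace A = (\<Sum>b\<in>Basis. w b)"
    by (rule dilation_diagonal)
  have P_bounded: "bounded_linear P"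
    using P(1) by (simp add: linear_linear)
  have "continuous_on {0<..} (\<lambda>s. P (diag (\<lambda>b. s powr w b) (P' x)))"
    unfolding diag_def
    by (intro bounded_linear.continuous_on[OF P_bounded] continuous_intros) auto
  then show "continuous_on {0<..} (\<lambda>s. dilation A s x)"
    by (rule continuous_on_eq) (simp add: D)
  have "((\<lambda>s. P (diag (\<lambda>b. s powr w b) (P' x))) \<longlongrightarrow> P (\<Sum>b\<in>Basis. (0 * (P' x \<bullet> b)) *\<^sub>R b)) (at_right 0)"
    unfolding diag_def
  proof (intro bounded_linear.tendsto[OF P_bounded] tendsto_intros)
    fix b :: 'a assume "b \<in> Basis"
    have "((\<lambda>s::real. s powr w b) \<longlongrightarrow> 0 powr w b) (at_right 0)"
      using w \<open>b \<in> Basis\<close> by (intro tendsto_powr') (auto simp: eventually_at_filter)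
    then show "((\<lambda>s::real. s powr w b) \<longlongrightarrow> 0) (at_right 0)"
      by simp
  qed
  then have "((\<lambda>s. P (diag (\<lambda>b. s powr w b) (P' x))) \<longlongrightarrow> 0) (at_right 0)"
    by (simp add: linear_0[OF P(1)])
  then show "((\<lambda>s. dilation A s x) \<longlongrightarrow> 0) (at_right 0)"
    by (rule Lim_transform_eventually) (auto simp: eventually_at_filter D)
qed

text \<open>
  The Jacobian determinant is unchanged by dilations, since \<open>log_deriv (D x) = D log_deriv x D\<inverse>\<close>.
  Contracting \<open>x\<close> to \<open>0\<close> identifies it with its value there, by continuity. So the exponential chart
  carries Lebesgue measure to Haar measure.
\<close>

lemma ldet_log_deriv: "ldet (log_deriv x) = 1"
proof -
  have scale: "ldet (log_deriv (dilation A s x)) = ldet (log_deriv x)" if s: "0 < s" for s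
  proof -
    have "log_deriv (dilation A s x) \<circ> dilation A s = dilation A s \<circ> log_deriv x"
      using log_deriv_morphism[OF dilation_morphism[OF s]] by (simp add: fun_eq_iff)
    then have "ldet (log_deriv (dilation A s x)) * ldet (dilation A s)
        = ldet (dilation A s) * ldet (log_deriv x)"
      using ldet_compose linear_log_deriv linear_dilation[OF s] by metis
    then show ?thesis
      using s by (simp add: ldet_dilation)
  qed
  have "continuous_on UNIV (\<lambda>y. ldet (log_deriv y))"
    by (intro continuous_ldet continuous_log_deriv)
  then have "isCont (\<lambda>y. ldet (log_deriv y)) 0"
    by (simp add: continuous_on_eq_continuous_at)
  then have "((\<lambda>s. ldet (log_deriv (dilation A s x))) \<longlongrightarrow> ldet (log_deriv 0)) (at_right 0)"
    by (rule isCont_tendsto_compose[OF _ dilation_tendsto_zero])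
  then have "((\<lambda>s. ldet (log_deriv x)) \<longlongrightarrow> ldet (log_deriv 0)) (at_right (0::real))"
    by (rule Lim_transform_eventually) (auto simp: eventually_at_filter scale)
  then have "ldet (log_deriv x) = ldet (log_deriv 0)"
    by (simp add: tendsto_const_iff)
  also have "log_deriv 0 = (\<lambda>v. v)"
    by (simp add: fun_eq_iff)
  finally show ?thesis by simp
qed

lemma ldet_translation: "\<bar>ldet (\<lambda>v. mult_deriv (inv E g, y) (0, v))\<bar> = 1"
proof -
  let ?L = "\<lambda>v. mult_deriv (inv E g, y) (0, v)"
  have "linear ?L"
    using translation_derivative has_derivative_linear by blast
  moreover have "log_deriv (inv E (g + E y)) \<circ> ?L = log_deriv y"
    by (simp add: fun_eq_iff log_deriv_translation)
  ultimately have "ldet (log_deriv (inv E (g + E y))) * ldet ?L = ldet (log_deriv y)"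
    using ldet_compose linear_log_deriv by metis
  then show ?thesis
    by (simp add: ldet_log_deriv)
qed

end

section \<open>Haar measure in the exponential chart\<close>

lemma haar_measure_left_translate:
  fixes \<mu> :: "'g::{topological_group_add, second_countable_topology} measure"
  assumes "haar_measure \<mu>" and [measurable]: "f \<in> borel_measurable borel"
  shows "(\<integral>\<^sup>+x. f (g + x) \<partial>\<mu>) = (\<integral>\<^sup>+x. f x \<partial>\<mu>)"
proof -
  have [measurable_cong]: "sets \<mu> = sets borel"
    using assms(1) by (simp add: haar_measure_def)
  have space: "space \<mu> = UNIV"
    using sets_eq_imp_space_eq[OF \<open>sets \<mu> = sets borel\<close>] by simp
  have [measurable]: "(+) g \<in> borel_measurable \<mu>"
    by measurable
  have "distr \<mu> borel ((+) g) = \<mu>"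
  proof (rule measure_eqI)
    fix S assume "S \<in> sets (distr \<mu> borel ((+) g))"
    then have S: "S \<in> sets borel" by simp
    have "(+) g -` S = (+) (- g) ` S"
    proof (intro equalityI subsetI)
      fix x assume "x \<in> (+) g -` S"
      moreover have "x = - g + (g + x)" by (simp add: add.assoc[symmetric])
      ultimately show "x \<in> (+) (- g) ` S" by (metis imageI vimageD)
    qed (auto simp: add.assoc[symmetric])
    then show "emeasure (distr \<mu> borel ((+) g)) S = emeasure \<mu> S"
      using assms(1) S by (simp add: emeasure_distr space haar_measure_def)
  qed (simp add: \<open>sets \<mu> = sets borel\<close>)
  then show ?thesis
    using nn_integral_distr[of "(+) g" \<mu> borel f] by simp
qed

text \<open>
  Integrate \<open>(y, x) \<mapsto> 1\<^sub>S(x) 1\<^sub>T(y\<inverse> x)\<close> in both orders. With \<open>x\<close> inside, the substitution \<open>x \<mapsto> y x\<close>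
  followed by right invariance of \<open>\<nu>\<close> gives \<open>\<mu>(T) \<nu>(S)\<close>; with \<open>y\<close> inside, the reflection \<open>y \<mapsto> y\<inverse>\<close> and right
  invariance give \<open>\<mu>(S) \<nu>(T)\<close>. Right invariance of \<open>\<nu>\<close> comes from left invariance and symmetry under
  inversion.
\<close>

lemma haar_measure_unique:
  fixes \<mu> \<nu> :: "'g::{topological_group_add, second_countable_topology} measure"
  assumes \<mu>: "haar_measure \<mu>" "sigma_finite_measure \<mu>"
    and \<nu>: "haar_measure \<nu>" "sigma_finite_measure \<nu>"
    and sym: "\<And>S. S \<in> sets borel \<Longrightarrow> emeasure \<nu> (uminus -` S) = emeasure \<nu> S"
    and S [measurable]: "S \<in> sets borel" and T [measurable]: "T \<in> sets borel"
  shows "emeasure \<mu> S * emeasure \<nu> T = emeasure \<mu> T * emeasure \<nu> S"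
proof -
  interpret M: sigma_finite_measure \<mu> by fact
  interpret N: sigma_finite_measure \<nu> by fact
  interpret pair_sigma_finite \<nu> \<mu> ..
  have [measurable_cong]: "sets \<mu> = sets borel" "sets \<nu> = sets borel"
    using \<mu> \<nu> by (simp_all add: haar_measure_def)
  have reflect: "(\<integral>\<^sup>+y. f (- y) \<partial>\<nu>) = (\<integral>\<^sup>+y. f y \<partial>\<nu>)" if [measurable]: "f \<in> borel_measurable borel" for f
  proof -
    have "space \<nu> = UNIV"
      using sets_eq_imp_space_eq[OF \<open>sets \<nu> = sets borel\<close>] by simp
    moreover have [measurable]: "uminus \<in> borel_measurable \<nu>"
      unfolding measurable_cong_sets[OF \<open>sets \<nu> = sets borel\<close> refl]
      by (intro borel_measurable_continuous_onI continuous_intros)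
    ultimately have "distr \<nu> borel uminus = \<nu>"
      by (intro measure_eqI) (auto simp: emeasure_distr sym \<open>sets \<nu> = sets borel\<close>)
    then show ?thesis
      using nn_integral_distr[of uminus \<nu> borel f] by simp
  qed
  have [measurable]: "uminus \<in> borel_measurable (borel :: 'g measure)"
    by (intro borel_measurable_continuous_onI continuous_intros)
  have right: "(\<integral>\<^sup>+y. f (y + x) \<partial>\<nu>) = (\<integral>\<^sup>+y. f y \<partial>\<nu>)" if [measurable]: "f \<in> borel_measurable borel" for f x
  proof -
    have "(\<integral>\<^sup>+y. f (y + x) \<partial>\<nu>) = (\<integral>\<^sup>+y. f (- y + x) \<partial>\<nu>)"
      by (rule reflect[symmetric]) measurable
    also have "\<dots> = (\<integral>\<^sup>+y. f (- (- x + y)) \<partial>\<nu>)"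
      by (simp add: minus_add)
    also have "\<dots> = (\<integral>\<^sup>+y. f (- y) \<partial>\<nu>)"
      by (rule haar_measure_left_translate[OF \<nu>(1)]) measurable
    also have "\<dots> = (\<integral>\<^sup>+y. f y \<partial>\<nu>)"
      by (rule reflect) measurable
    finally show ?thesis .
  qed
  define k where "k y x = (indicator S x * indicator T (- y + x) :: ennreal)" for x y :: 'g
  have [measurable]: "(\<lambda>(y, x). k y x) \<in> borel_measurable (\<nu> \<Otimes>\<^sub>M \<mu>)"
    unfolding k_def by measurable
  have "(\<integral>\<^sup>+y. \<integral>\<^sup>+x. k y x \<partial>\<mu> \<partial>\<nu>) = (\<integral>\<^sup>+y. \<integral>\<^sup>+x. indicator S (y + x) * indicator T x \<partial>\<mu> \<partial>\<nu>)"
  proof (rule nn_integral_cong)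
    fix y
    have "(\<integral>\<^sup>+x. k y (y + x) \<partial>\<mu>) = (\<integral>\<^sup>+x. k y x \<partial>\<mu>)"
      unfolding k_def by (rule haar_measure_left_translate[OF \<mu>(1)]) measurable
    then show "(\<integral>\<^sup>+x. k y x \<partial>\<mu>) = (\<integral>\<^sup>+x. indicator S (y + x) * indicator T x \<partial>\<mu>)"
      by (simp add: k_def add.assoc[symmetric])
  qed
  also have "\<dots> = (\<integral>\<^sup>+x. \<integral>\<^sup>+y. indicator S (y + x) * indicator T x \<partial>\<nu> \<partial>\<mu>)"
    by (rule Fubini'[symmetric]) measurable
  also have "\<dots> = (\<integral>\<^sup>+x. emeasure \<nu> S * indicator T x \<partial>\<mu>)"
  proof (rule nn_integral_cong)
    fix x
    have "(\<integral>\<^sup>+y. indicator S (y + x) * indicator T x \<partial>\<nu>) = (\<integral>\<^sup>+y. indicator S (y + x) \<partial>\<nu>) * indicator T x"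
      by (rule nn_integral_multc) measurable
    then show "(\<integral>\<^sup>+y. indicator S (y + x) * indicator T x \<partial>\<nu>) = emeasure \<nu> S * indicator T x"
      using right[of "indicator S" x] by (simp add: \<open>sets \<nu> = sets borel\<close>)
  qed
  also have "\<dots> = emeasure \<nu> S * emeasure \<mu> T"
    by (simp add: nn_integral_cmult_indicator \<open>sets \<mu> = sets borel\<close>)
  finally have one: "(\<integral>\<^sup>+y. \<integral>\<^sup>+x. k y x \<partial>\<mu> \<partial>\<nu>) = emeasure \<nu> S * emeasure \<mu> T" .
  have "(\<integral>\<^sup>+y. \<integral>\<^sup>+x. k y x \<partial>\<mu> \<partial>\<nu>) = (\<integral>\<^sup>+x. \<integral>\<^sup>+y. k y x \<partial>\<nu> \<partial>\<mu>)"
    by (rule Fubini'[symmetric]) measurable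
  also have "\<dots> = (\<integral>\<^sup>+x. indicator S x * emeasure \<nu> T \<partial>\<mu>)"
  proof (rule nn_integral_cong)
    fix x
    have "(\<integral>\<^sup>+y. k y x \<partial>\<nu>) = indicator S x * (\<integral>\<^sup>+y. indicator T (- y + x) \<partial>\<nu>)"
      unfolding k_def by (rule nn_integral_cmult) measurable
    also have "(\<integral>\<^sup>+y. indicator T (- y + x) \<partial>\<nu>) = (\<integral>\<^sup>+y. indicator T (y + x) \<partial>\<nu> :: ennreal)"
      by (rule reflect[of "\<lambda>y. indicator T (y + x)"]) measurable
    also have "\<dots> = emeasure \<nu> T"
      using right[of "indicator T" x] by (simp add: \<open>sets \<nu> = sets borel\<close>)
    finally show "(\<integral>\<^sup>+y. k y x \<partial>\<nu>) = indicator S x * emeasure \<nu> T" .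
  qed
  also have "\<dots> = emeasure \<mu> S * emeasure \<nu> T"
    by (subst nn_integral_multc) (simp_all add: \<open>sets \<mu> = sets borel\<close>)
  finally show ?thesis
    using one by (simp add: mult.commute)
qed

context exponential_lie_group
begin

lemma continuous_E: "continuous_on X E"
  and continuous_inv_E: "continuous_on Y (inv E)"
  using exp_homeomorphism by (auto simp: homeomorphism_def intro: continuous_on_subset)

text \<open>
  The group is a countable union of compact sets, the images of the balls of integral radius.
\<close>

lemma haar_sigma_finite:
  fixes \<mu> :: "'g measure"
  assumes "haar_measure \<mu>"
  shows "sigma_finite_measure \<mu>"
proof
  let ?K = "\<lambda>n :: nat. E ` cball 0 (real n)"
  have compact: "compact (?K n)" for n
    by (intro compact_continuous_image continuous_E compact_cball)
  have space: "space \<mu> = UNIV" "sets \<mu> = sets borel"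
    using assms sets_eq_imp_space_eq[of \<mu> borel] by (auto simp: haar_measure_def)
  have "g \<in> (\<Union>n. ?K n)" for g
  proof -
    obtain n where "norm (inv E g) \<le> real n"
      using real_arch_simple by blast
    then have "inv E g \<in> cball 0 (real n)" by simp
    then show ?thesis by (metis E_inv UN_I UNIV_I imageI)
  qed
  show "\<exists>A. countable A \<and> A \<subseteq> sets \<mu> \<and> \<Union> A = space \<mu> \<and> (\<forall>a\<in>A. emeasure \<mu> a \<noteq> \<infinity>)"
  proof (intro exI[of _ "range ?K"] conjI ballI)
    show "\<Union> (range ?K) = space \<mu>"
      using space \<open>\<And>g. g \<in> (\<Union>n. ?K n)\<close> by blast
    show "range ?K \<subseteq> sets \<mu>"
      using compact by (auto simp: space borel_compact)
    show "emeasure \<mu> K \<noteq> \<infinity>" if "K \<in> range ?K" for K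
      using that assms compact by (auto simp: haar_measure_def less_top[symmetric])
  qed simp
qed

end

context homogeneous_group
begin

definition exp_lebesgue :: "'g measure" where
  "exp_lebesgue = distr lborel borel E"

lemma sets_exp_lebesgue [simp]: "sets exp_lebesgue = sets borel"
  by (simp add: exp_lebesgue_def)

lemma E_measurable [measurable]: "E \<in> borel_measurable borel"
  by (intro borel_measurable_continuous_onI continuous_E)

lemma emeasure_exp_lebesgue:
  "S \<in> sets borel \<Longrightarrow> emeasure exp_lebesgue S = emeasure lborel (E -` S)"
  by (simp add: exp_lebesgue_def emeasure_distr)

text \<open>
  In the chart a left translation has Jacobian of modulus 1.
\<close>

lemma haar_exp_lebesgue: "haar_measure exp_lebesgue"
  unfolding haar_measure_def
proof (intro conjI allI impI ballI)
  fix K :: "'g set" assume "compact K"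
  then have "compact (inv E ` K)"
    by (intro compact_continuous_image continuous_inv_E)
  moreover have "inv E ` K = E -` K"
    by (force intro: image_eqI[of _ _ "E _"])
  ultimately show "emeasure exp_lebesgue K < \<infinity>"
    using \<open>compact K\<close> emeasure_bounded_finite[of "E -` K"]
    by (simp add: emeasure_exp_lebesgue borel_compact compact_imp_bounded)
next
  show "emeasure exp_lebesgue UNIV \<noteq> 0"
    by (simp add: emeasure_exp_lebesgue)
next
  fix g :: 'g and S :: "'g set" assume S: "S \<in> sets borel"
  let ?L = "\<lambda>y. inv E (g + E y)" and ?L' = "\<lambda>y. inv E (- g + E y)"
  have inverse: "?L' (?L y) = y" "?L (?L' y) = y" for y
    by (simp_all add: add.assoc[symmetric])
  have bij: "bij ?L"
    by (rule bij_betw_byWitness[where f' = ?L']) (auto simp: inverse)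
  have inv_L: "inv ?L = ?L'"
    by (rule inv_equality) (rule inverse)+
  have preimage: "E -` ((+) g ` S) = ?L ` (E -` S)"
  proof (intro equalityI subsetI)
    fix y assume "y \<in> E -` ((+) g ` S)"
    then obtain h where "h \<in> S" "E y = g + h" by auto
    then have "y = ?L (inv E h)" "inv E h \<in> E -` S"
      by (metis E_inv inv_E) (simp add: \<open>h \<in> S\<close>)
    then show "y \<in> ?L ` (E -` S)"
      by (rule image_eqI)
  qed auto
  have "(+) g ` S = (+) (- g) -` S"
  proof (intro equalityI subsetI)
    fix x assume "x \<in> (+) (- g) -` S"
    moreover have "x = g + (- g + x)" by (simp add: add.assoc[symmetric])
    ultimately show "x \<in> (+) g ` S" by (metis imageI vimageD)
  qed (auto simp: add.assoc[symmetric])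
  moreover have "(+) (- g) -` S \<in> sets borel"
  proof -
    have "(+) (- g) \<in> borel_measurable borel" by measurable
    from measurable_sets[OF this S] show ?thesis by simp
  qed
  ultimately have "(+) g ` S \<in> sets borel"
    by simp
  then have "emeasure exp_lebesgue ((+) g ` S) = emeasure lborel (?L ` (E -` S))"
    by (simp add: emeasure_exp_lebesgue preimage)
  also have "\<dots> = ennreal 1 * emeasure lborel (E -` S)"
  proof (rule emeasure_image_const_ldet[OF translation_derivative bij])
    show "continuous_on UNIV (inv ?L)"
      unfolding inv_L
      by (rule continuous_on_compose2[OF continuous_inv_E[of UNIV]])
        (auto intro: continuous_on_add continuous_on_const continuous_E)
    show "E -` S \<in> sets borel"
      using measurable_sets[OF E_measurable S] by simp
  qed (simp_all add: ldet_translation)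
  finally show "emeasure exp_lebesgue ((+) g ` S) = emeasure exp_lebesgue S"
    using S by (simp add: emeasure_exp_lebesgue)
qed simp

text \<open>
  In the chart the group inverse is \<open>x \<mapsto> - x\<close>.
\<close>

lemma exp_lebesgue_symmetric:
  assumes S: "S \<in> sets borel"
  shows "emeasure exp_lebesgue (uminus -` S) = emeasure exp_lebesgue S"
proof -
  have "uminus \<in> borel_measurable (borel :: 'g measure)"
    by (intro borel_measurable_continuous_onI continuous_intros)
  from measurable_sets[OF this S] have "uminus -` S \<in> sets borel"
    by simp
  then have "emeasure exp_lebesgue (uminus -` S) = emeasure lborel (E -` uminus -` S)"
    by (rule emeasure_exp_lebesgue)
  also have "E -` uminus -` S = uminus ` (E -` S)"
    by (force simp: E_minus intro: image_eqI[of _ _ "- _"])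
  also have "emeasure lborel \<dots> = ennreal 1 * emeasure lborel (E -` S)"
  proof (rule emeasure_image_const_ldet)
    show "(uminus has_derivative uminus) (at x)" for x :: 'a
      by (auto intro!: derivative_eq_intros)
    show "bij (uminus :: 'a \<Rightarrow> 'a)"
      by (rule bij_betw_byWitness[where f' = uminus]) auto
    have "inv (uminus :: 'a \<Rightarrow> 'a) = uminus"
      by (rule inv_equality) auto
    then show "continuous_on UNIV (inv (uminus :: 'a \<Rightarrow> 'a))"
      by (simp add: continuous_on_minus)
    show "\<bar>ldet (uminus :: 'a \<Rightarrow> 'a)\<bar> = 1"
      by (subst ldet_diagonal[where d = "\<lambda>_. - 1"]) (auto simp: abs_prod)
    show "E -` S \<in> sets borel"
      using measurable_sets[OF E_measurable S] by simp
  qed simp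
  finally show ?thesis
    using S by (simp add: emeasure_exp_lebesgue)
qed

text \<open>
  The constant is found by comparing both measures on the compact set \<open>E ` cball 0 1\<close>. It is not \<open>0\<close>
  because a Haar measure is not the zero measure.
\<close>

lemma haar_measure_eq_exp_lebesgue:
  assumes "haar_measure \<mu>"
  obtains c where "0 < c" "\<forall>S\<in>sets borel. emeasure \<mu> S = ennreal c * emeasure lborel (E -` S)"
proof -
  have unique: "emeasure \<mu> S * emeasure exp_lebesgue T = emeasure \<mu> T * emeasure exp_lebesgue S"
    if "S \<in> sets borel" "T \<in> sets borel" for S T
    using haar_measure_unique[OF assms haar_sigma_finite[OF assms] haar_exp_lebesgue
        haar_sigma_finite[OF haar_exp_lebesgue] exp_lebesgue_symmetric] that by simp
  let ?U = "E ` cball 0 1"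
  have "compact ?U"
    by (intro compact_continuous_image continuous_E compact_cball)
  then have U: "?U \<in> sets borel" "emeasure \<mu> ?U < \<infinity>"
    using assms by (auto simp: borel_compact haar_measure_def)
  have "E -` ?U = cball 0 1"
    using bij_E by (simp add: bij_is_inj inj_vimage_image_eq)
  then have lambda_U: "emeasure exp_lebesgue ?U = emeasure lborel (cball (0 :: 'a) 1)"
    using U by (simp add: emeasure_exp_lebesgue)
  obtain v where v: "0 < v" "emeasure exp_lebesgue ?U = ennreal v"
  proof
    show "0 < measure lborel (cball (0 :: 'a) 1)"
      by (rule content_cball_pos) simp
    show "emeasure exp_lebesgue ?U = ennreal (measure lborel (cball (0 :: 'a) 1))"
      using emeasure_lborel_cball_finite[of "0 :: 'a" 1]
      by (simp add: lambda_U emeasure_eq_ennreal_measure)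
  qed
  obtain m where m: "0 \<le> m" "emeasure \<mu> ?U = ennreal m"
    using U(2) by (cases "emeasure \<mu> ?U") auto
  have eq: "emeasure \<mu> S = ennreal (m / v) * emeasure lborel (E -` S)" if "S \<in> sets borel" for S
  proof -
    have "emeasure \<mu> S * ennreal v * ennreal (1 / v) = ennreal m * ennreal (1 / v) * emeasure exp_lebesgue S"
      using unique[OF that U(1)] v m by (simp add: mult_ac)
    moreover have "ennreal v * ennreal (1 / v) = 1" "ennreal m * ennreal (1 / v) = ennreal (m / v)"
      using v m by (simp_all flip: ennreal_mult)
    ultimately show ?thesis
      using that by (simp add: mult.assoc emeasure_exp_lebesgue)
  qed
  moreover have "m \<noteq> 0"
    using eq[of UNIV] assms by (auto simp: haar_measure_def)
  ultimately show ?thesis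
    using that[of "m / v"] m v by simp
qed

lemma continuous_quasi_norm_exp:
  assumes "homogeneous_quasi_norm E A N"
  shows "continuous_on X (\<lambda>x. N (E x))"
  by (rule continuous_on_compose2[OF _ continuous_E subset_UNIV])
    (use assms in \<open>simp add: homogeneous_quasi_norm_def\<close>)

lemma quasi_norm_dilation:
  assumes "homogeneous_quasi_norm E A N" "0 < s"
  shows "N (E (dilation A s x)) = s * N (E x)"
proof -
  have "N (group_dilation E A s (E x)) = s * N (E x)"
    using assms by (simp add: homogeneous_quasi_norm_def)
  then show ?thesis by (simp add: group_dilation_def)
qed

text \<open>
  Let \<open>\<eta>\<close> be the minimum of the quasi-norm on the unit sphere. A point outside the unit ball is moved
  onto the sphere by some dilation with factor \<open>s \<le> 1\<close>, by the intermediate value theorem, and this does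
  not increase its quasi-norm; so the quasi-norm is at least \<open>\<eta>\<close> outside the unit ball.
\<close>

lemma quasi_norm_ball_bounded:
  assumes N: "homogeneous_quasi_norm E A N"
  obtains \<eta> where "0 < \<eta>" "{x. N (E x) < \<eta>} \<subseteq> ball 0 1"
proof -
  note cont = continuous_quasi_norm_exp[OF N]
  note hom = quasi_norm_dilation[OF N]
  have pos: "0 < N (E x)" if "x \<noteq> 0" for x
  proof -
    have "E x \<noteq> 0" using that by (metis E_zero inv_E)
    then show ?thesis
      using N by (metis homogeneous_quasi_norm_def less_eq_real_def)
  qed
  have "sphere (0 :: 'a) 1 \<noteq> {}" by simp
  then obtain z :: 'a where z: "z \<in> sphere 0 1" "\<And>x. x \<in> sphere 0 1 \<Longrightarrow> N (E z) \<le> N (E x)"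
    using continuous_attains_inf[OF compact_sphere _ cont, of 0 1] by auto
  have "norm x < 1" if x: "N (E x) < N (E z)" for x
  proof (rule ccontr)
    assume "\<not> norm x < 1"
    then have norm_x: "1 \<le> norm x" by simp
    have one: "dilation A 1 x = x"
      unfolding dilation_def by (subst suminf_finite[of "{0}"]) auto
    have "\<forall>\<^sub>F s in at_right 0. dist (dilation A s x) 0 < 1"
      using dilation_tendsto_zero[of x] by (rule tendstoD) simp
    then obtain b where b: "0 < b" "\<And>s. 0 < s \<Longrightarrow> s < b \<Longrightarrow> norm (dilation A s x) < 1"
      by (auto simp: eventually_at_right_field)
    define s0 where "s0 = min (b / 2) (1 / 2)"
    have s0: "0 < s0" "s0 \<le> 1" "norm (dilation A s0 x) \<le> 1"
      using b(1) b(2)[of s0] by (auto simp: s0_def min_def field_simps intro: less_imp_le)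
    have "continuous_on {s0..1} (\<lambda>s. norm (dilation A s x))"
      using s0 by (intro continuous_on_norm continuous_on_subset[OF continuous_dilation]) auto
    then obtain s where s: "s0 \<le> s" "s \<le> 1" "norm (dilation A s x) = 1"
      using IVT'[of "\<lambda>s. norm (dilation A s x)" s0 1 1] s0 norm_x one by auto
    have "N (E z) \<le> N (E (dilation A s x))"
      using s by (intro z) simp
    also have "\<dots> = s * N (E x)"
      using s s0 by (intro hom) simp
    also have "\<dots> \<le> N (E x)"
      using s s0 N by (intro mult_left_le_one_le) (auto simp: homogeneous_quasi_norm_def)
    finally show False using x by simp
  qed
  moreover have "0 < N (E z)"
    using z(1) by (intro pos) auto
  ultimately show ?thesis
    by (intro that[of "N (E z)"]) auto
qed

text \<open>
  The ball of radius \<open>r\<close> is the dilation by \<open>r\<close> of the unit ball, and this dilation has determinant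
  \<open>r powr Q\<close>. The unit ball has positive measure because it is a neighbourhood of the identity, and finite
  measure because it is a dilation of a bounded set.
\<close>

lemma emeasure_quasi_ball:
  assumes N: "homogeneous_quasi_norm E A N" and \<mu>: "haar_measure \<mu>"
  obtains \<kappa> where "0 < \<kappa>" "\<forall>r>0. emeasure \<mu> {g. N g < r} = ennreal (\<kappa> * r powr operator_trace A)"
proof -
  let ?Q = "operator_trace A" and ?V = "\<lambda>r. {x. N (E x) < r}"
  have open_V: "open (?V r)" for r
    by (intro open_Collect_less continuous_on_const continuous_quasi_norm_exp[OF N])
  note hom = quasi_norm_dilation[OF N]
  have scaling: "emeasure lborel (?V (s * r)) = ennreal (s powr ?Q) * emeasure lborel (?V r)" if s: "0 < s" for s r
  proof -
    have inverse: "dilation A (1 / s) (dilation A s x) = x" "dilation A s (dilation A (1 / s) x) = x" for x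
      using dilation_inverse[of s x] dilation_inverse[of "1 / s" x] s by simp_all
    have bij: "bij (dilation A s)"
      by (rule bij_betw_byWitness[where f' = "dilation A (1 / s)"]) (auto simp: inverse)
    have inv_D: "inv (dilation A s) = dilation A (1 / s)"
      by (rule inv_equality) (rule inverse)+
    have "?V (s * r) = dilation A s ` ?V r"
    proof (intro equalityI subsetI)
      fix x assume "x \<in> ?V (s * r)"
      then have "dilation A (1 / s) x \<in> ?V r"
        using s by (simp add: hom field_simps)
      then show "x \<in> dilation A s ` ?V r"
        by (metis imageI inverse(2))
    qed (use s in \<open>auto simp: hom\<close>)
    moreover have "emeasure lborel (dilation A s ` ?V r) = ennreal (s powr ?Q) * emeasure lborel (?V r)"
    proof (rule emeasure_image_const_ldet[OF _ bij])
      show "(dilation A s has_derivative dilation A s) (at x)" for x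
        using linear_dilation[OF s] by (rule linear_imp_has_derivative)
      show "continuous_on UNIV (inv (dilation A s))"
        unfolding inv_D using linear_dilation[of "1 / s"] s by (simp add: linear_continuous_on linear_linear)
    qed (use s open_V in \<open>auto simp: ldet_dilation\<close>)
    ultimately show ?thesis by simp
  qed
  obtain \<eta> where \<eta>: "0 < \<eta>" "?V \<eta> \<subseteq> ball 0 1"
    using quasi_norm_ball_bounded[OF N] .
  have "emeasure lborel (?V \<eta>) < \<infinity>"
    using emeasure_mono[OF \<eta>(2), of lborel] emeasure_lborel_ball_finite[of "0 :: 'a" 1]
    by (auto intro: order_le_less_trans)
  then have finite: "emeasure lborel (?V 1) < \<infinity>"
    using scaling[of "1 / \<eta>" \<eta>] \<eta>(1) by (simp add: ennreal_mult_less_top)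
  have "N 0 = 0"
    using N by (simp add: homogeneous_quasi_norm_def)
  then have "0 \<in> ?V 1" by simp
  then obtain e where e: "0 < e" "ball 0 e \<subseteq> ?V 1"
    using open_V[of 1] open_contains_ball by blast
  have "0 < measure lborel (ball (0 :: 'a) e)"
    by (rule content_ball_pos[OF e(1)])
  also have "\<dots> \<le> measure lborel (?V 1)"
    using finite open_V by (intro measure_mono_fmeasurable e) (auto simp: fmeasurable_def)
  finally have pos: "0 < measure lborel (?V 1)" .
  obtain c where c: "0 < c" "\<forall>S\<in>sets borel. emeasure \<mu> S = ennreal c * emeasure lborel (E -` S)"
    using haar_measure_eq_exp_lebesgue[OF \<mu>] .
  show ?thesis
  proof
    show "0 < c * measure lborel (?V 1)"
      using c(1) pos by simp
    show "\<forall>r>0. emeasure \<mu> {g. N g < r} = ennreal (c * measure lborel (?V 1) * r powr ?Q)"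
    proof (intro allI impI)
      fix r :: real assume r: "0 < r"
      have "open {g. N g < r}"
        using N by (intro open_Collect_less continuous_on_const) (simp add: homogeneous_quasi_norm_def)
      then have "emeasure \<mu> {g. N g < r} = ennreal c * emeasure lborel (?V r)"
        using c(2) by (simp add: vimage_def)
      also have "\<dots> = ennreal c * (ennreal (r powr ?Q) * ennreal (measure lborel (?V 1)))"
        using scaling[OF r, of 1] finite by (simp add: emeasure_eq_ennreal_measure)
      also have "\<dots> = ennreal (c * measure lborel (?V 1) * r powr ?Q)"
        using c(1) by (simp flip: ennreal_mult add: mult_ac)
      finally show "emeasure \<mu> {g. N g < r} = ennreal (c * measure lborel (?V 1) * r powr ?Q)" .
    qed
  qed
qed

end

section \<open>The maximal operator over a chain of balls\<close>

text \<open>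
  The maximal operator in terms of \<open>u = |f|\<close>, so that it can be applied to truncations of \<open>|f|\<close>. Its value
  at \<open>x\<close> depends on \<open>N x\<close> alone.
\<close>

definition radial_max :: "'g::{topological_space, group_add} measure \<Rightarrow> ('g \<Rightarrow> real) \<Rightarrow> ('g \<Rightarrow> ennreal) \<Rightarrow> 'g \<Rightarrow> ennreal" where
  "radial_max \<mu> N u x =
     (SUP r\<in>{r. 0 < r \<and> N x < r}. (\<integral>\<^sup>+y\<in>{y. N y < r}. u y \<partial>\<mu>) / emeasure \<mu> {y. N y < r})"

lemma ennreal_mult_divide_le: "x * y / y \<le> (x :: ennreal)"
  by (cases "y = 0 \<or> y = top") (auto simp: divide_ennreal_def ennreal_mult_divide_eq[unfolded divide_ennreal_def])

lemma ennreal_divide_mult_le: "x / y * y \<le> (x :: ennreal)"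
  using ennreal_mult_divide_le[of x y] by (simp only: ennreal_divide_times ennreal_times_divide)

lemma quasi_ball_zero: "quasi_ball N 0 r = {x. N x < r}"
  by (simp add: quasi_ball_def)

locale radial_measure =
  fixes \<mu> :: "'g::{topological_space, group_add} measure" and N :: "'g \<Rightarrow> real"
  assumes sets_eq [measurable_cong]: "sets \<mu> = sets borel" and continuous_N: "continuous_on UNIV N"
begin

lemma space_eq [simp]: "space \<mu> = UNIV"
  using sets_eq_imp_space_eq[OF sets_eq] by simp

lemma open_ball: "open {y. N y < r}"
  using continuous_N by (intro open_Collect_less continuous_intros)

lemma N_measurable [measurable]: "N \<in> borel_measurable \<mu>"
  using borel_measurable_continuous_onI[OF continuous_N] by (simp cong: measurable_cong_sets add: sets_eq)

lemma ball_sets [measurable]: "{y. N y < r} \<in> sets \<mu>"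
  by (simp add: sets_eq open_ball borel_open)

text \<open>
  Serves twice: it makes superlevel sets open, hence the maximal function measurable although it is an
  uncountable supremum, and it reduces the weak type estimate to single balls.
\<close>

lemma superlevel_eq:
  "{x. t < radial_max \<mu> N u x} = (\<Union>r\<in>{r. 0 < r \<and> t < (\<integral>\<^sup>+y\<in>{y. N y < r}. u y \<partial>\<mu>) / emeasure \<mu> {y. N y < r}}. {y. N y < r})"
  by (auto simp: radial_max_def less_SUP_iff)

lemma open_superlevel: "open {x. t < radial_max \<mu> N u x}"
  unfolding superlevel_eq by (auto intro: open_ball)

lemma radial_max_measurable [measurable]: "radial_max \<mu> N u \<in> borel_measurable \<mu>"
  by (rule borel_measurableI_greater) (simp add: sets_eq open_superlevel borel_open)

text \<open>
  Every ball whose average exceeds \<open>t\<close> satisfies the estimate. The superlevel set is the union of these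
  balls, which form a chain, and continuity of the measure from below carries the estimate over to it.
\<close>

lemma weak_type: "ennreal t * emeasure \<mu> {x. ennreal t < radial_max \<mu> N u x} \<le> (\<integral>\<^sup>+x. u x \<partial>\<mu>)"
proof -
  let ?B = "\<lambda>r. {y. N y < r}"
  define Z where "Z = {r. 0 < r \<and> ennreal t < (\<integral>\<^sup>+y\<in>?B r. u y \<partial>\<mu>) / emeasure \<mu> (?B r)}"
  have level: "{x. ennreal t < radial_max \<mu> N u x} = (\<Union>r\<in>Z. ?B r)"
    unfolding Z_def by (rule superlevel_eq)
  have ball: "ennreal t * emeasure \<mu> (?B r) \<le> (\<integral>\<^sup>+x. u x \<partial>\<mu>)" if "r \<in> Z" for r
  proof -
    have "ennreal t * emeasure \<mu> (?B r)
        \<le> (\<integral>\<^sup>+y\<in>?B r. u y \<partial>\<mu>) / emeasure \<mu> (?B r) * emeasure \<mu> (?B r)"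
      using that by (intro mult_right_mono) (auto simp: Z_def less_imp_le)
    also have "\<dots> \<le> (\<integral>\<^sup>+y\<in>?B r. u y \<partial>\<mu>)"
      by (rule ennreal_divide_mult_le)
    also have "\<dots> \<le> (\<integral>\<^sup>+x. u x \<partial>\<mu>)"
      by (intro nn_integral_mono) (auto simp: indicator_def)
    finally show ?thesis .
  qed
  \<comment> \<open>The index set \<open>Z\<close> is uncountable in general. Covering the corresponding union of half-lines by countably
    many of them yields a cofinal sequence of radii in \<open>Z\<close>.\<close>
  obtain F where F: "F \<subseteq> lessThan ` Z" "countable F" "\<Union>F = \<Union>(lessThan ` Z)"
    using Lindelof[of "lessThan ` Z"] by (metis (no_types, lifting) image_iff open_lessThan)
  obtain D where D: "D \<subseteq> Z" "countable D" "F = lessThan ` D"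
    using countable_subset_image[THEN iffD1, OF conjI, OF F(2,1)] by blast
  have "(\<Union>r\<in>Z. ?B r) = (\<Union>r\<in>D. ?B r)"
    using F(3) unfolding D(3) by (auto simp: set_eq_iff)
  show ?thesis
  proof (cases "D = {}")
    case True
    then show ?thesis using level \<open>(\<Union>r\<in>Z. ?B r) = (\<Union>r\<in>D. ?B r)\<close> by simp
  next
    case False
    \<comment> \<open>Running maxima make the sequence of radii increasing.\<close>
    define \<rho> where "\<rho> n = Max (from_nat_into D ` {..n})" for n :: nat
    have \<rho>_in: "\<rho> n \<in> D" for n
    proof -
      have "\<rho> n \<in> from_nat_into D ` {..n}"
        unfolding \<rho>_def by (rule Max_in) auto
      then show ?thesis using from_nat_into[OF False] by auto
    qed
    have \<rho>_ge: "from_nat_into D n \<le> \<rho> n" for n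
      unfolding \<rho>_def by (rule Max_ge) auto
    have "mono \<rho>"
      unfolding \<rho>_def by (intro monoI Max_mono image_mono) auto
    then have inc: "incseq (\<lambda>n. ?B (\<rho> n))"
      by (auto simp: incseq_def mono_def intro: less_le_trans)
    have "(\<Union>r\<in>D. ?B r) = (\<Union>n. ?B (\<rho> n))"
    proof (intro equalityI subsetI)
      fix x assume "x \<in> (\<Union>r\<in>D. ?B r)"
      then obtain r where "r \<in> D" "N x < r" by auto
      moreover obtain n where "from_nat_into D n = r"
        using from_nat_into_surj[OF D(2) \<open>r \<in> D\<close>] by blast
      ultimately show "x \<in> (\<Union>n. ?B (\<rho> n))"
        using \<rho>_ge[of n] by (auto intro: less_le_trans)
    qed (use \<rho>_in in auto)
    then have "emeasure \<mu> {x. ennreal t < radial_max \<mu> N u x} = (SUP n. emeasure \<mu> (?B (\<rho> n)))"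
      using SUP_emeasure_incseq[of "\<lambda>n. ?B (\<rho> n)" \<mu>] inc ball_sets level
        \<open>(\<Union>r\<in>Z. ?B r) = (\<Union>r\<in>D. ?B r)\<close> by (simp add: image_subset_iff)
    then have "ennreal t * emeasure \<mu> {x. ennreal t < radial_max \<mu> N u x}
        = (SUP n. ennreal t * emeasure \<mu> (?B (\<rho> n)))"
      by (simp add: SUP_mult_left_ennreal)
    also have "\<dots> \<le> (\<integral>\<^sup>+x. u x \<partial>\<mu>)"
      using ball \<rho>_in D(1) by (intro SUP_least) auto
    finally show ?thesis .
  qed
qed

text \<open>
  Discarding from \<open>h\<close> its values up to \<open>t\<close> lowers every average by at most \<open>t\<close>.
\<close>

lemma weak_type_truncated:
  assumes [measurable]: "h \<in> borel_measurable \<mu>" and t: "0 < t"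
  shows "ennreal t * emeasure \<mu> {x. ennreal (2 * t) < radial_max \<mu> N (\<lambda>x. ennreal (h x)) x}
    \<le> (\<integral>\<^sup>+x. ennreal (h x) * indicator {x. t < h x} x \<partial>\<mu>)"
proof -
  let ?u = "\<lambda>x. ennreal (h x)" and ?v = "\<lambda>x. ennreal (h x) * indicator {x. t < h x} x"
  let ?B = "\<lambda>r. {y. N y < r}"
  have sets[measurable]: "{x. t < h x} \<in> sets \<mu>"
    using measurable_sets[OF assms(1), of "{t<..}"] by (simp add: vimage_def)
  have "radial_max \<mu> N ?u x \<le> radial_max \<mu> N ?v x + ennreal t" for x
    unfolding radial_max_def
  proof (rule SUP_least)
    fix r assume r: "r \<in> {r. 0 < r \<and> N x < r}"
    have "(\<integral>\<^sup>+y\<in>?B r. ?u y \<partial>\<mu>) \<le> (\<integral>\<^sup>+y. ?v y * indicator (?B r) y + ennreal t * indicator (?B r) y \<partial>\<mu>)"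
      by (intro nn_integral_mono) (auto simp: indicator_def ennreal_leI)
    also have "\<dots> = (\<integral>\<^sup>+y\<in>?B r. ?v y \<partial>\<mu>) + ennreal t * emeasure \<mu> (?B r)"
      by (subst nn_integral_add) (auto simp: nn_integral_cmult_indicator)
    finally have "(\<integral>\<^sup>+y\<in>?B r. ?u y \<partial>\<mu>) / emeasure \<mu> (?B r)
        \<le> (\<integral>\<^sup>+y\<in>?B r. ?v y \<partial>\<mu>) / emeasure \<mu> (?B r) + ennreal t * emeasure \<mu> (?B r) / emeasure \<mu> (?B r)"
      unfolding add_divide_distrib_ennreal[symmetric] by (rule divide_right_mono_ennreal)
    also have "\<dots> \<le> (SUP r\<in>{r. 0 < r \<and> N x < r}. (\<integral>\<^sup>+y\<in>?B r. ?v y \<partial>\<mu>) / emeasure \<mu> (?B r)) + ennreal t"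
      using r by (intro add_mono SUP_upper ennreal_mult_divide_le)
    finally show "(\<integral>\<^sup>+y\<in>?B r. ?u y \<partial>\<mu>) / emeasure \<mu> (?B r) \<le> \<dots>" .
  qed
  then have sub: "{x. ennreal (2 * t) < radial_max \<mu> N ?u x} \<subseteq> {x. ennreal t < radial_max \<mu> N ?v x}"
  proof (intro Collect_mono impI)
    fix x assume "ennreal (2 * t) < radial_max \<mu> N ?u x"
    also have "\<dots> \<le> radial_max \<mu> N ?v x + ennreal t" by fact
    finally have "ennreal t + ennreal t < radial_max \<mu> N ?v x + ennreal t"
      using t by (simp flip: ennreal_plus)
    then show "ennreal t < radial_max \<mu> N ?v x"
      by (meson add_right_mono leD leI)
  qed
  have "ennreal t * emeasure \<mu> {x. ennreal (2 * t) < radial_max \<mu> N ?u x}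
      \<le> ennreal t * emeasure \<mu> {x. ennreal t < radial_max \<mu> N ?v x}"
    by (intro mult_left_mono emeasure_mono sub) (auto simp: sets_eq open_superlevel borel_open)
  also have "\<dots> \<le> (\<integral>\<^sup>+x. ?v x \<partial>\<mu>)"
    by (rule weak_type)
  finally show ?thesis .
qed

end

lemma ennreal_powr_ennreal [simp]: "0 \<le> x \<Longrightarrow> ennreal_powr (ennreal x) a = ennreal (x powr a)"
  by (simp add: ennreal_powr_def)

lemma ennreal_powr_top [simp]: "ennreal_powr top a = top"
  by (simp add: ennreal_powr_def)

lemma ennreal_powr_measurable [measurable (raw)]:
  assumes [measurable]: "f \<in> borel_measurable M"
  shows "(\<lambda>x. ennreal_powr (f x) a) \<in> borel_measurable M"
  unfolding ennreal_powr_def by measurable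

lemma ennreal_powr_mono: "0 \<le> a \<Longrightarrow> x \<le> y \<Longrightarrow> ennreal_powr x a \<le> ennreal_powr y a"
  by (cases x; cases y) (auto simp: top_unique intro!: ennreal_leI powr_mono2)

lemma ennreal_powr_le_iff:
  assumes "0 < a" "0 \<le> c"
  shows "ennreal_powr y a \<le> ennreal c \<longleftrightarrow> y \<le> ennreal (c powr (1 / a))"
proof (cases y)
  case (real x)
  have "x powr a \<le> c \<longleftrightarrow> x \<le> c powr (1 / a)"
  proof
    assume "x powr a \<le> c"
    then have "(x powr a) powr (1 / a) \<le> c powr (1 / a)"
      using assms by (intro powr_mono2) auto
    then show "x \<le> c powr (1 / a)"
      using assms real by (simp add: powr_powr)
  next
    assume "x \<le> c powr (1 / a)"
    then have "x powr a \<le> (c powr (1 / a)) powr a"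
      using assms real by (intro powr_mono2) auto
    then show "x powr a \<le> c"
      using assms by (simp add: powr_powr)
  qed
  with real assms show ?thesis by simp
qed (simp add: top_unique)

lemma nn_integral_powr:
  assumes "0 < q" "0 \<le> c"
  shows "(\<integral>\<^sup>+t. ennreal (q * t powr (q - 1)) * indicator {0<..<c} t \<partial>lborel) = ennreal (c powr q)"
proof -
  have "((\<lambda>t. t powr (q - 1)) has_integral (c powr (q - 1 + 1) / (q - 1 + 1))) {0..c}"
    by (rule has_integral_powr_from_0) (use assms in auto)
  from has_integral_mult_right[OF this, of q]
  have "((\<lambda>t. q * t powr (q - 1)) has_integral c powr q) {0..c}"
    using assms by simp
  then have "(\<integral>\<^sup>+t. ennreal (q * t powr (q - 1)) * indicator {0..c} t \<partial>lborel) = ennreal (c powr q)"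
    using nn_integral_has_integral_lborel assms
      by (intro nn_integral_has_integral_lebesgue') auto
  moreover have "(\<integral>\<^sup>+t. ennreal (q * t powr (q - 1)) * indicator {0<..<c} t \<partial>lborel)
      = (\<integral>\<^sup>+t. ennreal (q * t powr (q - 1)) * indicator {0..c} t \<partial>lborel)"
    using AE_lborel_singleton[of 0] AE_lborel_singleton[of c]
    by (intro nn_integral_cong_AE) (auto simp: indicator_def elim!: eventually_elim2)
  ultimately show ?thesis by simp
qed

lemma layer_cake:
  assumes "0 < q"
  shows "ennreal_powr y q
    = (\<integral>\<^sup>+t. ennreal (q * t powr (q - 1)) * indicator {t. 0 < t \<and> ennreal t < y} t \<partial>lborel)"
proof (cases y)
  case (real c)
  then have "{t. 0 < t \<and> ennreal t < y} = {0<..<c}"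
    by (auto simp: ennreal_less_iff)
  then show ?thesis
    using real nn_integral_powr[OF assms, of c] by simp
next
  case top
  have "ennreal (real n powr q) \<le>
      (\<integral>\<^sup>+t. ennreal (q * t powr (q - 1)) * indicator {t. 0 < t \<and> ennreal t < y} t \<partial>lborel)" for n
    unfolding nn_integral_powr[OF assms, of "real n", simplified, symmetric]
    by (intro nn_integral_mono) (auto simp: indicator_def top)
  moreover have "\<exists>n. x < real n powr q" for x
  proof -
    obtain n where "\<bar>x\<bar> powr (1 / q) < real n"
      using reals_Archimedean2 by blast
    then have "(\<bar>x\<bar> powr (1 / q)) powr q < real n powr q"
      using assms by (intro powr_less_mono2) auto
    then show ?thesis
      using assms by (auto simp: powr_powr intro: order_le_less_trans[OF abs_ge_self])
  qed
  ultimately have "(\<integral>\<^sup>+t. ennreal (q * t powr (q - 1)) * indicator {t. 0 < t \<and> ennreal t < y} t \<partial>lborel) \<noteq> ennreal x"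
    for x
    by (metis ennreal_le_iff2 ennreal_less_iff leD linorder_not_le order_le_less_trans powr_ge_zero ennreal_lessI)
  then have "(\<integral>\<^sup>+t. ennreal (q * t powr (q - 1)) * indicator {t. 0 < t \<and> ennreal t < y} t \<partial>lborel) = top"
    by (metis ennreal_cases)
  then show ?thesis
    by (simp add: top)
qed

context radial_measure
begin

text \<open>
  Insert the truncated weak type estimate into the layer cake formula and interchange the integrals:
  the integral of \<open>(M h) powr p\<close> is at most that of \<open>p t powr (p - 1) (2 / t) h(x)\<close> over the pairs with
  \<open>0 < t < 2 h(x)\<close>, and the integral over \<open>t\<close> converges at \<open>0\<close> because \<open>p > 1\<close>.
\<close>

lemma strong_type:
  assumes "sigma_finite_measure \<mu>" and [measurable]: "h \<in> borel_measurable \<mu>" and h: "\<And>x. 0 \<le> h x" and p: "1 < p"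
  shows "(\<integral>\<^sup>+x. ennreal_powr (radial_max \<mu> N (\<lambda>x. ennreal (h x)) x) p \<partial>\<mu>)
    \<le> ennreal (2 powr p * p / (p - 1)) * (\<integral>\<^sup>+x. ennreal (h x powr p) \<partial>\<mu>)"
proof -
  interpret sigma_finite_measure \<mu> by fact
  interpret pair_sigma_finite lborel \<mu> ..
  let ?M = "radial_max \<mu> N (\<lambda>x. ennreal (h x))"
  let ?w = "\<lambda>t. ennreal (p * t powr (p - 1))"
  have M_meas: "?M \<in> borel_measurable \<mu>" by measurable
  have level_sets: "{x. ennreal t < ?M x} \<in> sets \<mu>" for t
    by (simp add: sets_eq open_superlevel borel_open)
  have "(\<integral>\<^sup>+x. ennreal_powr (?M x) p \<partial>\<mu>)
      = (\<integral>\<^sup>+x. \<integral>\<^sup>+t. ?w t * indicator {t. 0 < t \<and> ennreal t < ?M x} t \<partial>lborel \<partial>\<mu>)"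
    using p by (simp add: layer_cake)
  also have "\<dots> = (\<integral>\<^sup>+x. \<integral>\<^sup>+t. (?w t * indicator {0<..} t) * indicator {z. ennreal (fst z) < ?M (snd z)} (t, x) \<partial>lborel \<partial>\<mu>)"
    by (intro nn_integral_cong) (auto simp: indicator_def)
  also have "\<dots> = (\<integral>\<^sup>+t. \<integral>\<^sup>+x. (?w t * indicator {0<..} t) * indicator {z. ennreal (fst z) < ?M (snd z)} (t, x) \<partial>\<mu> \<partial>lborel)"
    using M_meas by (intro Fubini') measurable
  also have "\<dots> = (\<integral>\<^sup>+t. (?w t * indicator {0<..} t) * emeasure \<mu> {x. ennreal t < ?M x} \<partial>lborel)"
  proof (intro nn_integral_cong)
    fix t :: real
    have "(\<integral>\<^sup>+x. (?w t * indicator {0<..} t) * indicator {z. ennreal (fst z) < ?M (snd z)} (t, x) \<partial>\<mu>)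
        = (\<integral>\<^sup>+x. (?w t * indicator {0<..} t) * indicator {x. ennreal t < ?M x} x \<partial>\<mu>)"
      by (intro nn_integral_cong) (auto simp: indicator_def)
    then show "(\<integral>\<^sup>+x. (?w t * indicator {0<..} t) * indicator {z. ennreal (fst z) < ?M (snd z)} (t, x) \<partial>\<mu>)
        = (?w t * indicator {0<..} t) * emeasure \<mu> {x. ennreal t < ?M x}"
      using nn_integral_cmult_indicator[OF level_sets] by simp
  qed
  also have "\<dots> \<le> (\<integral>\<^sup>+t. \<integral>\<^sup>+x. ennreal (2 * p * t powr (p - 2)) * indicator {0<..} t
      * (ennreal (h x) * indicator {z. fst z < 2 * h (snd z)} (t, x)) \<partial>\<mu> \<partial>lborel)"
  proof (intro nn_integral_mono)
    fix t :: real
    show "(?w t * indicator {0<..} t) * emeasure \<mu> {x. ennreal t < ?M x}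
       \<le> (\<integral>\<^sup>+x. ennreal (2 * p * t powr (p - 2)) * indicator {0<..} t
      * (ennreal (h x) * indicator {z. fst z < 2 * h (snd z)} (t, x)) \<partial>\<mu>)"
    proof (cases "0 < t")
      case True
      have split: "?w t = ennreal (2 * p * t powr (p - 2)) * ennreal (t / 2)"
        using True p powr_add[of t "p - 2" 1] by (simp add: ennreal_mult[symmetric])
      have "?w t * emeasure \<mu> {x. ennreal t < ?M x}
         = ennreal (2 * p * t powr (p - 2)) * (ennreal (t / 2) * emeasure \<mu> {x. ennreal (2 * (t / 2)) < ?M x})"
        unfolding split by (simp add: mult.assoc)
      also have "\<dots> \<le> ennreal (2 * p * t powr (p - 2)) * (\<integral>\<^sup>+x. ennreal (h x) * indicator {x. t / 2 < h x} x \<partial>\<mu>)"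
        using True by (intro mult_left_mono weak_type_truncated) auto
      also have "\<dots> = (\<integral>\<^sup>+x. ennreal (2 * p * t powr (p - 2)) * (ennreal (h x) * indicator {x. t / 2 < h x} x) \<partial>\<mu>)"
      proof -
        have [measurable]: "{x. t / 2 < h x} \<in> sets \<mu>"
          using measurable_sets[OF assms(2), of "{t / 2<..}"] by (simp add: vimage_def)
        show ?thesis by (rule nn_integral_cmult[symmetric]) measurable
      qed
      also have "\<dots> = (\<integral>\<^sup>+x. ennreal (2 * p * t powr (p - 2)) * (ennreal (h x) * indicator {z. fst z < 2 * h (snd z)} (t, x)) \<partial>\<mu>)"
        by (intro nn_integral_cong) (auto simp: indicator_def)
      finally show ?thesis
        using True by simp
    qed simp
  qed
  also have "\<dots> = (\<integral>\<^sup>+x. \<integral>\<^sup>+t. ennreal (2 * p * t powr (p - 2)) * indicator {0<..} t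
      * (ennreal (h x) * indicator {z. fst z < 2 * h (snd z)} (t, x)) \<partial>lborel \<partial>\<mu>)"
    by (intro Fubini'[symmetric]) measurable
  also have "\<dots> = (\<integral>\<^sup>+x. ennreal (2 powr p * p / (p - 1)) * ennreal (h x powr p) \<partial>\<mu>)"
  proof (intro nn_integral_cong)
    fix x
    let ?c = "2 * p / (p - 1) * h x"
    have "(\<integral>\<^sup>+t. ennreal (2 * p * t powr (p - 2)) * indicator {0<..} t
        * (ennreal (h x) * indicator {z. fst z < 2 * h (snd z)} (t, x)) \<partial>lborel)
      = (\<integral>\<^sup>+t. ennreal ?c * (ennreal ((p - 1) * t powr (p - 1 - 1)) * indicator {0<..<2 * h x} t) \<partial>lborel)"
      using p h[of x]
      by (intro nn_integral_cong)
        (auto simp: indicator_def ennreal_mult[symmetric] field_simps)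
    also have "\<dots> = ennreal ?c * ennreal ((2 * h x) powr (p - 1))"
      using p h[of x] nn_integral_powr[of "p - 1" "2 * h x"] by (subst nn_integral_cmult) simp_all
    also have "\<dots> = ennreal (2 powr p * p / (p - 1)) * ennreal (h x powr p)"
    proof -
      have "2 powr p = 2 * 2 powr (p - 1)" "h x powr p = h x * h x powr (p - 1)"
        using h[of x] p by (simp_all add: powr_mult_base)
      then show ?thesis
        using p h[of x] by (simp add: ennreal_mult[symmetric] powr_mult field_simps)
    qed
    finally show "(\<integral>\<^sup>+t. ennreal (2 * p * t powr (p - 2)) * indicator {0<..} t
        * (ennreal (h x) * indicator {z. fst z < 2 * h (snd z)} (t, x)) \<partial>lborel)
      = ennreal (2 powr p * p / (p - 1)) * ennreal (h x powr p)" .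
  qed
  also have "\<dots> = ennreal (2 powr p * p / (p - 1)) * (\<integral>\<^sup>+x. ennreal (h x powr p) \<partial>\<mu>)"
    by (rule nn_integral_cmult) measurable
  finally show ?thesis .
qed

end

lemma ennreal_scale_le_iff:
  assumes "0 < c" "0 \<le> d"
  shows "ennreal (1 / c) * x \<le> ennreal d \<longleftrightarrow> x \<le> ennreal (c * d)"
  using assms by (cases x) (auto simp: ennreal_mult[symmetric] ennreal_mult_top top_unique field_simps)

text \<open>
  Removes the roots and quotients: a Morrey bound is a bound on the integrals of \<open>u powr p\<close> over balls.
\<close>

lemma morrey_norm_le_iff:
  assumes "0 < p" and \<phi>: "\<And>t. 0 < t \<Longrightarrow> 0 < \<phi> t" and "0 \<le> K"
  shows "morrey_norm \<mu> N Q p \<phi> u \<le> ennreal K \<longleftrightarrow>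
    (\<forall>r>0. (\<integral>\<^sup>+x\<in>quasi_ball N 0 r. ennreal_powr (u x) p \<partial>\<mu>) \<le> ennreal (r powr Q * (\<phi> r * K) powr p))"
proof -
  have "ennreal (1 / \<phi> r) * ennreal_powr (ennreal (1 / r powr Q) * x) (1 / p) \<le> ennreal K
      \<longleftrightarrow> x \<le> ennreal (r powr Q * (\<phi> r * K) powr p)" if "0 < r" for r x
  proof -
    have nonneg: "0 \<le> \<phi> r * K"
      using \<phi>[OF that] \<open>0 \<le> K\<close> by simp
    show ?thesis
      using ennreal_scale_le_iff[OF \<phi>[OF that] \<open>0 \<le> K\<close>] ennreal_powr_le_iff[of "1 / p", OF _ nonneg]
        ennreal_scale_le_iff[of "r powr Q" "(\<phi> r * K) powr p" x] \<open>0 < p\<close> that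
      by simp
  qed
  then show ?thesis
    by (auto simp: morrey_norm_def SUP_le_iff)
qed

text \<open>
  Jensen's inequality up to the factor 2, from the pointwise bound \<open>h \<le> a + a powr (1 - p) * h powr p\<close>.
\<close>

lemma (in radial_measure) radial_max_outer_bound:
  fixes a p r :: real
  assumes [measurable]: "h \<in> borel_measurable \<mu>" and h: "\<And>x. 0 \<le> h x" and p: "1 < p" and a: "0 < a"
    and bound: "(\<integral>\<^sup>+x\<in>{x. N x < r}. ennreal (h x powr p) \<partial>\<mu>) \<le> ennreal (a powr p) * emeasure \<mu> {x. N x < r}"
  shows "(\<integral>\<^sup>+x\<in>{x. N x < r}. ennreal (h x) \<partial>\<mu>) / emeasure \<mu> {x. N x < r} \<le> ennreal (2 * a)"
proof -
  let ?B = "{x. N x < r}"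
  have young: "h x \<le> a + a powr (1 - p) * h x powr p" for x
  proof (cases "h x \<le> a")
    case True
    then show ?thesis by (simp add: add_increasing2)
  next
    case False
    then have "a powr (p - 1) \<le> h x powr (p - 1)"
      using a p by (intro powr_mono2) auto
    then have "h x * a powr (p - 1) \<le> h x * h x powr (p - 1)"
      using h by (rule mult_left_mono)
    then have "h x * a powr (p - 1) \<le> h x powr p"
      using powr_mult_base[of "h x" "p - 1"] h by simp
    then have "a powr (1 - p) * (h x * a powr (p - 1)) \<le> a powr (1 - p) * h x powr p"
      by (rule mult_left_mono) simp
    also have "a powr (1 - p) * (h x * a powr (p - 1)) = h x * (a powr (1 - p) * a powr (p - 1))"
      by (simp add: algebra_simps)
    also have "a powr (1 - p) * a powr (p - 1) = 1"
      using a by (simp flip: powr_add)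
    finally show ?thesis using a by simp
  qed
  have "(\<integral>\<^sup>+x\<in>?B. ennreal (h x) \<partial>\<mu>)
      \<le> (\<integral>\<^sup>+x. ennreal a * indicator ?B x + ennreal (a powr (1 - p)) * (ennreal (h x powr p) * indicator ?B x) \<partial>\<mu>)"
    using a h by (intro nn_integral_mono)
      (auto simp: indicator_def young ennreal_leI ennreal_mult[symmetric] ennreal_plus[symmetric] simp del: ennreal_plus)
  also have "\<dots> = ennreal a * emeasure \<mu> ?B + ennreal (a powr (1 - p)) * (\<integral>\<^sup>+x\<in>?B. ennreal (h x powr p) \<partial>\<mu>)"
    by (subst nn_integral_add) (auto simp: nn_integral_cmult_indicator nn_integral_cmult)
  also have "\<dots> \<le> ennreal a * emeasure \<mu> ?B + ennreal (a powr (1 - p)) * (ennreal (a powr p) * emeasure \<mu> ?B)"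
    by (intro add_left_mono mult_left_mono bound) simp
  also have "ennreal (a powr (1 - p)) * (ennreal (a powr p) * emeasure \<mu> ?B) = ennreal a * emeasure \<mu> ?B"
  proof -
    have "ennreal (a powr (1 - p)) * ennreal (a powr p) = ennreal a"
      using a by (simp add: ennreal_mult[symmetric] powr_add[symmetric])
    then show ?thesis by (simp add: mult.assoc[symmetric])
  qed
  also have "ennreal a * emeasure \<mu> ?B + ennreal a * emeasure \<mu> ?B = ennreal (2 * a) * emeasure \<mu> ?B"
  proof -
    have "ennreal (2 * a) = ennreal a + ennreal a"
      using a by (simp flip: ennreal_plus)
    then show ?thesis
      by (simp only: distrib_right)
  qed
  finally have "(\<integral>\<^sup>+x\<in>?B. ennreal (h x) \<partial>\<mu>) / emeasure \<mu> ?B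
      \<le> ennreal (2 * a) * emeasure \<mu> ?B / emeasure \<mu> ?B"
    by (rule divide_right_mono_ennreal)
  also have "\<dots> \<le> ennreal (2 * a)"
    by (rule ennreal_mult_divide_le)
  finally show ?thesis .
qed

text \<open>
  Fix \<open>R\<close> and a point of the ball of radius \<open>R\<close>. Averages over radii \<open>r \<le> R\<close> see only the restriction of
  \<open>h\<close> to this ball, and the strong type estimate bounds their contribution. Averages over radii \<open>r > R\<close> are
  at most a multiple of \<open>\<phi> r\<close>, hence of \<open>\<phi> R\<close> since \<open>\<phi>\<close> is nonincreasing; the integral of this constant over
  the ball has the right size because the ball has measure \<open>\<kappa> R powr Q\<close>. The constant obtained depends on
  \<open>p\<close> only, as \<open>\<kappa>\<close> cancels.
\<close>

lemma (in radial_measure) morrey_norm_radial_max: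
  fixes \<kappa> Q p K :: real
  assumes ball: "\<And>r. 0 < r \<Longrightarrow> emeasure \<mu> {x. N x < r} = ennreal (\<kappa> * r powr Q)" and \<kappa>: "0 < \<kappa>"
    and sf: "sigma_finite_measure \<mu>"
    and p: "1 < p" and \<phi>: "morrey_weight Q p \<phi>"
    and [measurable]: "h \<in> borel_measurable \<mu>" and h: "\<And>x. 0 \<le> h x"
    and K: "0 < K" and norm_h: "morrey_norm \<mu> N Q p \<phi> (\<lambda>x. ennreal (h x)) \<le> ennreal K"
  shows "morrey_norm \<mu> N Q p \<phi> (radial_max \<mu> N (\<lambda>x. ennreal (h x)))
    \<le> ennreal ((2 powr p * p / (p - 1) + 2 powr p) powr (1 / p) * K)"
proof -
  let ?B = "\<lambda>r. {x. N x < r}" and ?C = "2 powr p * p / (p - 1)"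
  have \<phi>_pos: "0 < \<phi> t" if "0 < t" for t
    using \<phi> that by (auto simp: morrey_weight_def)
  have \<phi>_anti: "\<phi> t \<le> \<phi> s" if "0 < s" "s \<le> t" for s t
    using \<phi> that by (auto simp: morrey_weight_def monotone_on_def)
  have int_h: "(\<integral>\<^sup>+x\<in>?B r. ennreal (h x powr p) \<partial>\<mu>) \<le> ennreal (r powr Q * (\<phi> r * K) powr p)" if "0 < r" for r
    using norm_h p K that h by (simp add: morrey_norm_le_iff \<phi>_pos quasi_ball_zero)
  have C_pos: "0 < ?C" using p by simp
  show ?thesis
  proof (subst morrey_norm_le_iff)
    show "\<forall>R>0. (\<integral>\<^sup>+x\<in>quasi_ball N 0 R. ennreal_powr (radial_max \<mu> N (\<lambda>x. ennreal (h x)) x) p \<partial>\<mu>)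
       \<le> ennreal (R powr Q * (\<phi> R * ((?C + 2 powr p) powr (1 / p) * K)) powr p)"
    proof (intro allI impI)
      fix R :: real assume R: "0 < R"
      \<comment> \<open>Chosen such that \<open>a powr p\<close> bounds the means of \<open>h powr p\<close> over all balls of radius at least \<open>R\<close>.\<close>
      define a where "a = \<kappa> powr (- 1 / p) * (\<phi> R * K)"
      have a: "0 < a"
        using \<kappa> K \<phi>_pos[OF R] by (simp add: a_def)
      have a_powr: "a powr p * \<kappa> = (\<phi> R * K) powr p"
      proof -
        have "a powr p = (\<kappa> powr (- 1 / p)) powr p * (\<phi> R * K) powr p"
          unfolding a_def by (rule powr_mult)
        also have "(\<kappa> powr (- 1 / p)) powr p = \<kappa> powr (- 1)"
          unfolding powr_powr using p by simp
        also have "\<dots> = 1 / \<kappa>"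
          using \<kappa> by (simp add: powr_minus_divide)
        finally show ?thesis
          using \<kappa> by simp
      qed
      define h1 where "h1 x = h x * indicator (?B R) x" for x
      have [measurable]: "h1 \<in> borel_measurable \<mu>"
        unfolding h1_def[abs_def] by measurable
      have h1: "0 \<le> h1 x" for x
        using h by (simp add: h1_def)
      have pointwise: "radial_max \<mu> N (\<lambda>x. ennreal (h x)) x
          \<le> max (radial_max \<mu> N (\<lambda>x. ennreal (h1 x)) x) (ennreal (2 * a))" for x
        unfolding radial_max_def[of _ _ "\<lambda>x. ennreal (h x)"]
      proof (rule SUP_least)
        fix r assume r: "r \<in> {r. 0 < r \<and> N x < r}"
        show "(\<integral>\<^sup>+y\<in>?B r. ennreal (h y) \<partial>\<mu>) / emeasure \<mu> (?B r)
            \<le> max (radial_max \<mu> N (\<lambda>x. ennreal (h1 x)) x) (ennreal (2 * a))"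
        proof (cases "r \<le> R")
          case True
          have "(\<integral>\<^sup>+y\<in>?B r. ennreal (h y) \<partial>\<mu>) = (\<integral>\<^sup>+y\<in>?B r. ennreal (h1 y) \<partial>\<mu>)"
            using True by (intro nn_integral_cong) (auto simp: h1_def indicator_def)
          then have "(\<integral>\<^sup>+y\<in>?B r. ennreal (h y) \<partial>\<mu>) / emeasure \<mu> (?B r) \<le> radial_max \<mu> N (\<lambda>x. ennreal (h1 x)) x"
            unfolding radial_max_def by (intro SUP_upper2[OF r]) simp
          then show ?thesis by (simp add: max.coboundedI1)
        next
          case False
          have "(\<integral>\<^sup>+x\<in>?B r. ennreal (h x powr p) \<partial>\<mu>) \<le> ennreal (r powr Q * (\<phi> r * K) powr p)"
            using r by (intro int_h) simp
          also have "\<dots> \<le> ennreal (r powr Q * (\<phi> R * K) powr p)"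
            using False R K p \<phi>_pos[of r] \<phi>_anti[of R r]
            by (intro ennreal_leI mult_left_mono powr_mono2 mult_right_mono) auto
          also have "\<dots> = ennreal (a powr p) * emeasure \<mu> (?B r)"
          proof -
            have "r powr Q * (\<phi> R * K) powr p = a powr p * (\<kappa> * r powr Q)"
              unfolding a_powr[symmetric] by (simp only: mult_ac)
            then have "ennreal (r powr Q * (\<phi> R * K) powr p) = ennreal (a powr p) * ennreal (\<kappa> * r powr Q)"
              using \<kappa> by (simp only: ennreal_mult[symmetric] powr_ge_zero mult_nonneg_nonneg less_imp_le)
            then show ?thesis
              using r by (simp add: ball)
          qed
          finally have "(\<integral>\<^sup>+y\<in>?B r. ennreal (h y) \<partial>\<mu>) / emeasure \<mu> (?B r) \<le> ennreal (2 * a)"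
            by (rule radial_max_outer_bound[OF \<open>h \<in> borel_measurable \<mu>\<close> h p a])
          then show ?thesis by (simp add: max.coboundedI2)
        qed
      qed
      have "(\<integral>\<^sup>+x\<in>?B R. ennreal_powr (radial_max \<mu> N (\<lambda>x. ennreal (h x)) x) p \<partial>\<mu>)
          \<le> (\<integral>\<^sup>+x. ennreal_powr (radial_max \<mu> N (\<lambda>x. ennreal (h1 x)) x) p + ennreal ((2 * a) powr p) * indicator (?B R) x \<partial>\<mu>)"
      proof (intro nn_integral_mono)
        fix x
        have "ennreal_powr (radial_max \<mu> N (\<lambda>x. ennreal (h x)) x) p
            \<le> ennreal_powr (max (radial_max \<mu> N (\<lambda>x. ennreal (h1 x)) x) (ennreal (2 * a))) p"
          using p by (intro ennreal_powr_mono pointwise) simp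
        also have "\<dots> \<le> ennreal_powr (radial_max \<mu> N (\<lambda>x. ennreal (h1 x)) x) p + ennreal ((2 * a) powr p)"
          using a by (auto simp: max_def add_increasing add_increasing2)
        finally show "ennreal_powr (radial_max \<mu> N (\<lambda>x. ennreal (h x)) x) p * indicator (?B R) x
            \<le> ennreal_powr (radial_max \<mu> N (\<lambda>x. ennreal (h1 x)) x) p + ennreal ((2 * a) powr p) * indicator (?B R) x"
          by (auto simp: indicator_def)
      qed
      also have "\<dots> = (\<integral>\<^sup>+x. ennreal_powr (radial_max \<mu> N (\<lambda>x. ennreal (h1 x)) x) p \<partial>\<mu>)
          + ennreal ((2 * a) powr p) * emeasure \<mu> (?B R)"
        by (subst nn_integral_add) (auto simp: nn_integral_cmult_indicator)
      also have "\<dots> \<le> ennreal ?C * (\<integral>\<^sup>+x. ennreal (h1 x powr p) \<partial>\<mu>) + ennreal ((2 * a) powr p) * emeasure \<mu> (?B R)"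
        by (intro add_right_mono strong_type sf h1 p) measurable
      also have "(\<integral>\<^sup>+x. ennreal (h1 x powr p) \<partial>\<mu>) = (\<integral>\<^sup>+x\<in>?B R. ennreal (h x powr p) \<partial>\<mu>)"
        using p by (intro nn_integral_cong) (auto simp: h1_def indicator_def)
      also have "ennreal ?C * \<dots> + ennreal ((2 * a) powr p) * emeasure \<mu> (?B R)
          \<le> ennreal ?C * ennreal (R powr Q * (\<phi> R * K) powr p) + ennreal ((2 * a) powr p) * emeasure \<mu> (?B R)"
        by (intro add_right_mono mult_left_mono int_h R) simp
      also have "\<dots> = ennreal (R powr Q * (\<phi> R * ((?C + 2 powr p) powr (1 / p) * K)) powr p)"
      proof -
        define Y where "Y = (\<phi> R * K) powr p"
        have "(2 * a) powr p * (\<kappa> * R powr Q) = 2 powr p * (a powr p * \<kappa>) * R powr Q"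
          unfolding powr_mult by (simp only: mult_ac)
        then have outer: "(2 * a) powr p * (\<kappa> * R powr Q) = 2 powr p * Y * R powr Q"
          by (simp only: a_powr Y_def)
        have "\<phi> R * ((?C + 2 powr p) powr (1 / p) * K) = (?C + 2 powr p) powr (1 / p) * (\<phi> R * K)"
          by (simp only: mult_ac)
        then have "(\<phi> R * ((?C + 2 powr p) powr (1 / p) * K)) powr p = ((?C + 2 powr p) powr (1 / p)) powr p * Y"
          by (simp only: powr_mult[of "(?C + 2 powr p) powr (1 / p)"] Y_def)
        also have "((?C + 2 powr p) powr (1 / p)) powr p = ?C + 2 powr p"
          unfolding powr_powr using p C_pos by simp
        finally have total: "(\<phi> R * ((?C + 2 powr p) powr (1 / p) * K)) powr p = (?C + 2 powr p) * Y" .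
        have "ennreal ?C * ennreal (R powr Q * Y) + ennreal ((2 * a) powr p) * emeasure \<mu> (?B R)
            = ennreal (?C * (R powr Q * Y) + (2 * a) powr p * (\<kappa> * R powr Q))"
        proof -
          have nonneg: "0 \<le> ?C" "0 \<le> R powr Q * Y" "0 \<le> (2 * a) powr p" "0 \<le> \<kappa> * R powr Q"
            using C_pos \<kappa> by (simp_all add: Y_def)
          show ?thesis
            unfolding ball[OF R] ennreal_mult[OF nonneg(1,2), symmetric] ennreal_mult[OF nonneg(3,4), symmetric]
            by (intro ennreal_plus[symmetric] mult_nonneg_nonneg nonneg)
        qed
        also have "?C * (R powr Q * Y) + (2 * a) powr p * (\<kappa> * R powr Q) = R powr Q * ((?C + 2 powr p) * Y)"
          unfolding outer by (simp only: algebra_simps)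
        finally show ?thesis
          unfolding total Y_def .
      qed
      finally show "(\<integral>\<^sup>+x\<in>quasi_ball N 0 R. ennreal_powr (radial_max \<mu> N (\<lambda>x. ennreal (h x)) x) p \<partial>\<mu>)
         \<le> ennreal (R powr Q * (\<phi> R * ((?C + 2 powr p) powr (1 / p) * K)) powr p)"
        by (simp add: quasi_ball_zero)
    qed
  qed (use p K \<phi>_pos in auto)
qed

section \<open>Boundedness on generalised Morrey spaces\<close>

lemma maximal_operator_eq: "maximal_operator \<mu> N f = radial_max \<mu> N (\<lambda>x. ennreal (norm (f x)))"
  by (simp add: fun_eq_iff maximal_operator_def radial_max_def quasi_ball_zero)

theorem theorem3p2:
  fixes E :: "'a::euclidean_space \<Rightarrow> 'g::{topological_group_add, t2_space, second_countable_topology}"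
    and A :: "'a \<Rightarrow> 'a" and N :: "'g \<Rightarrow> real" and \<mu> :: "'g measure" and Q p :: real
  assumes "homogeneous_group E A"
    and "Q = operator_trace A"
    and "homogeneous_quasi_norm E A N"
    and "haar_measure \<mu>"
    and "1 < p"
  shows "\<exists>C>0. \<forall>\<phi>. morrey_weight Q p \<phi> \<longrightarrow>
           (\<forall>f\<in>morrey_space \<mu> N Q p \<phi>.
              morrey_norm \<mu> N Q p \<phi> (maximal_operator \<mu> N f)
                \<le> ennreal C * morrey_norm \<mu> N Q p \<phi> (\<lambda>x. ennreal (norm (f x))))"
proof -
  interpret homogeneous_group E A by fact
  interpret radial_measure \<mu> N
    using assms(3,4) by unfold_locales (auto simp: haar_measure_def homogeneous_quasi_norm_def)
  obtain \<kappa> where \<kappa>: "0 < \<kappa>" "\<forall>r>0. emeasure \<mu> {g. N g < r} = ennreal (\<kappa> * r powr Q)"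
    using emeasure_quasi_ball[OF assms(3,4)] assms(2) by blast
  define C where "C = (2 powr p * p / (p - 1) + 2 powr p) powr (1 / p)"
  have "0 < 2 powr p * p / (p - 1) + 2 powr p"
    using assms(5) by (intro add_pos_pos) auto
  then have C: "0 < C"
    by (simp add: C_def)
  have "morrey_norm \<mu> N Q p \<phi> (maximal_operator \<mu> N f)
      \<le> ennreal C * morrey_norm \<mu> N Q p \<phi> (\<lambda>x. ennreal (norm (f x)))"
    if \<phi>: "morrey_weight Q p \<phi>" and f: "f \<in> morrey_space \<mu> N Q p \<phi>" for \<phi> f
  proof -
    let ?u = "\<lambda>x. ennreal (norm (f x))"
    have f_meas: "(\<lambda>x. norm (f x)) \<in> borel_measurable \<mu>" and finite: "morrey_norm \<mu> N Q p \<phi> ?u < \<infinity>"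
      using f by (auto simp: morrey_space_def Lp_loc_def)
    have bound: "morrey_norm \<mu> N Q p \<phi> (maximal_operator \<mu> N f) \<le> ennreal (C * K)"
      if "0 < K" "morrey_norm \<mu> N Q p \<phi> ?u \<le> ennreal K" for K
      unfolding maximal_operator_eq C_def
      using morrey_norm_radial_max[OF _ \<kappa>(1) haar_sigma_finite[OF assms(4)] assms(5) \<phi> f_meas _ that] \<kappa>(2)
      by simp
    obtain K where K: "0 \<le> K" "morrey_norm \<mu> N Q p \<phi> ?u = ennreal K"
      using finite by (cases "morrey_norm \<mu> N Q p \<phi> ?u") auto
    have "morrey_norm \<mu> N Q p \<phi> (maximal_operator \<mu> N f) \<le> ennreal (C * K)"
    \<comment> \<open>The bound was derived for \<open>K > 0\<close>; the slack \<open>e\<close> covers a function of norm \<open>0\<close>.\<close>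
    proof (rule ennreal_le_epsilon)
      fix e :: real assume e: "0 < e"
      have "morrey_norm \<mu> N Q p \<phi> (maximal_operator \<mu> N f) \<le> ennreal (C * (K + e / C))"
        using K C e by (intro bound) (auto intro!: add_nonneg_pos ennreal_leI)
      also have "C * (K + e / C) = C * K + e"
        using C by (simp add: field_simps)
      also have "ennreal (C * K + e) = ennreal (C * K) + ennreal e"
        using K C e by simp
      finally show "morrey_norm \<mu> N Q p \<phi> (maximal_operator \<mu> N f) \<le> ennreal (C * K) + ennreal e" .
    qed
    then show ?thesis
      using K C by (simp add: ennreal_mult)
  qed
  then show ?thesis
    using C by blast
qed

end
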